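(* The hypergroup $\operatorname{Irr}(\mathrm{SU}(3))$ satisfies the $18240$-Leptin condition.
   Context: $\mathrm{SU}(3)$ is the compact group of $3\times3$ unitary matrices of determinant $1$. For a compact group $G$, $\operatorname{Irr}(G)$ is the set of equivalence classes of irreducible unitary representations of $G$; $d_\pi$ is the dimension of $\pi$. It is a discrete commutative hypergroup with convolution $\delta_\pi*\delta_\sigma=\sum_\rho \frac{m_\rho d_\rho}{d_\pi d_\sigma}\delta_\rho$, where $\pi\otimes\sigma\cong\bigoplus_\rho m_\rho\,\rho$, with involution the conjugate representation and identity the trivial representation. Its Haar measure is $\lambda(E)=\sum_{\pi\in E}d_\pi^2$. For $A,B\subseteq\operatorname{Irr}(G)$, $A*B=\bigcup_{\pi\in A,\sigma\in B}\operatorname{supp}(\delta_\pi*\delta_\sigma)$, i.e. the set of all irreducible representations occurring in some $\pi\otimes\sigma$ with $\pi\in A$, $\sigma\in B$. $D$-Leptin condition (for an integer $D\ge1$): for every compact (here: finite) $K\subseteq\operatorname{Irr}(G)$ and $\epsilon>0$ there is $V\subseteq\operatorname{Irr}(G)$ with $0<\lambda(V)<\infty$ and $\lambda(K*V)/\lambda(V)<D+\epsilon$. *)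

theory Defs
  imports "HOL-Analysis.Analysis" "HOL-Algebra.Group" "Jordan_Normal_Form.Schur_Decomposition"
begin

text \<open>
  A topological group is a HOL-Algebra monoid record over a type with a topology, its carrier
  bearing the subspace topology. Since both HOL-Analysis and the matrices of type \<open>mat\<close> are loaded,
  clashing names are written in qualified form.
\<close>

definition SU3 :: "(complex^3^3) monoid" where
  "SU3 = \<lparr>carrier = {A. A ** map_matrix cnj (Finite_Cartesian_Product.transpose A) = Finite_Cartesian_Product.mat 1
                        \<and> Determinants.det A = 1},
          monoid.mult = (**), one = Finite_Cartesian_Product.mat 1\<rparr>"

subsection \<open>Unitary representations\<close>

text \<open>
  Irreducible unitary representations of a compact group are finite-dimensional, so, up to
  equivalence, a representation acts on some $\mathbb{C}^n$ with its standard inner product.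
  It is a matrix-valued function of which only the values on the carrier matter.
\<close>

definition unitary_group :: "nat \<Rightarrow> complex mat monoid" where
  "unitary_group n = \<lparr>carrier = {U \<in> carrier_mat n n. mat_adjoint U * U = 1\<^sub>m n},
                      monoid.mult = (*), one = 1\<^sub>m n\<rparr>"

definition rep_dim :: "'a monoid \<Rightarrow> ('a \<Rightarrow> complex mat) \<Rightarrow> nat" where
  "rep_dim G \<rho> = dim_row (\<rho> \<one>\<^bsub>G\<^esub>)"

definition unitary_rep :: "'a::topological_space monoid \<Rightarrow> ('a \<Rightarrow> complex mat) \<Rightarrow> bool" where
  "unitary_rep G \<rho> \<longleftrightarrow>
     \<rho> \<in> hom G (unitary_group (rep_dim G \<rho>)) \<and>
     (\<forall>i<rep_dim G \<rho>. \<forall>j<rep_dim G \<rho>. continuous_on (carrier G) (\<lambda>g. \<rho> g $$ (i, j)))"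

definition irreducible_rep :: "'a monoid \<Rightarrow> ('a \<Rightarrow> complex mat) \<Rightarrow> bool" where
  "irreducible_rep G \<rho> \<longleftrightarrow> (let n = rep_dim G \<rho> in
     n > 0 \<and>
     (\<forall>W. VectorSpace.subspace class_ring W (module_vec TYPE(complex) n) \<and>
          (\<forall>g\<in>carrier G. \<forall>w\<in>W. \<rho> g *\<^sub>v w \<in> W) \<longrightarrow>
          W = {0\<^sub>v n} \<or> W = carrier_vec n))"

definition irreps :: "'a::topological_space monoid \<Rightarrow> ('a \<Rightarrow> complex mat) set" where
  "irreps G = {\<rho>. unitary_rep G \<rho> \<and> irreducible_rep G \<rho>}"

definition rep_equiv :: "'a monoid \<Rightarrow> ('a \<Rightarrow> complex mat) \<Rightarrow> ('a \<Rightarrow> complex mat) \<Rightarrow> bool" where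
  "rep_equiv G \<rho> \<sigma> \<longleftrightarrow>
     rep_dim G \<rho> = rep_dim G \<sigma> \<and>
     (\<exists>U\<in>carrier (unitary_group (rep_dim G \<rho>)). \<forall>g\<in>carrier G. U * \<rho> g = \<sigma> g * U)"

definition Irr :: "'a::topological_space monoid \<Rightarrow> ('a \<Rightarrow> complex mat) set set" where
  "Irr G = irreps G // {(\<rho>, \<sigma>). \<rho> \<in> irreps G \<and> \<sigma> \<in> irreps G \<and> rep_equiv G \<rho> \<sigma>}"

definition irr_rep :: "('a \<Rightarrow> complex mat) set \<Rightarrow> 'a \<Rightarrow> complex mat" where
  "irr_rep \<pi> = (SOME \<rho>. \<rho> \<in> \<pi>)"

definition irr_dim :: "'a monoid \<Rightarrow> ('a \<Rightarrow> complex mat) set \<Rightarrow> nat" where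
  "irr_dim G \<pi> = rep_dim G (irr_rep \<pi>)"

subsection \<open>Tensor products and direct sums\<close>

definition kronecker_mat :: "complex mat \<Rightarrow> complex mat \<Rightarrow> complex mat" where
  "kronecker_mat A B = Matrix.mat (dim_row A * dim_row B) (dim_col A * dim_col B)
     (\<lambda>(i, j). A $$ (i div dim_row B, j div dim_col B) * B $$ (i mod dim_row B, j mod dim_col B))"

definition tensor_rep :: "('a \<Rightarrow> complex mat) \<Rightarrow> ('a \<Rightarrow> complex mat) \<Rightarrow> 'a \<Rightarrow> complex mat" where
  "tensor_rep \<rho> \<sigma> = (\<lambda>g. kronecker_mat (\<rho> g) (\<sigma> g))"

definition direct_sum_rep :: "('a \<Rightarrow> complex mat) list \<Rightarrow> 'a \<Rightarrow> complex mat" where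
  "direct_sum_rep \<rho>s = (\<lambda>g. diag_block_mat (map (\<lambda>\<rho>. \<rho> g) \<rho>s))"

text \<open>
  The number of summands in the class \<open>\<rho>\<close> in a decomposition of \<open>\<tau>\<close> into irreducibles; for a
  finite-dimensional unitary \<open>\<tau>\<close> a decomposition exists and this number does not depend on it.
\<close>

definition multiplicity_rep ::
  "'a::topological_space monoid \<Rightarrow> ('a \<Rightarrow> complex mat) \<Rightarrow> ('a \<Rightarrow> complex mat) set \<Rightarrow> nat" where
  "multiplicity_rep G \<tau> \<rho> = (THE m. \<exists>\<rho>s. set \<rho>s \<subseteq> irreps G \<and> rep_equiv G \<tau> (direct_sum_rep \<rho>s) \<and>
     m = length (filter (\<lambda>r. r \<in> \<rho>) \<rho>s))"

subsection \<open>The hypergroup of irreducible representations\<close>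

text \<open>\<open>irr_conv G \<pi> \<sigma> \<rho>\<close> is the mass of $\delta_\pi * \delta_\sigma$ at \<open>\<rho>\<close>.\<close>

definition irr_conv :: "'a::topological_space monoid \<Rightarrow> ('a \<Rightarrow> complex mat) set \<Rightarrow>
    ('a \<Rightarrow> complex mat) set \<Rightarrow> ('a \<Rightarrow> complex mat) set \<Rightarrow> real" where
  "irr_conv G \<pi> \<sigma> \<rho> =
     real (multiplicity_rep G (tensor_rep (irr_rep \<pi>) (irr_rep \<sigma>)) \<rho>) * real (irr_dim G \<rho>)
       / (real (irr_dim G \<pi>) * real (irr_dim G \<sigma>))"

definition irr_prod :: "'a::topological_space monoid \<Rightarrow> ('a \<Rightarrow> complex mat) set set \<Rightarrow>
    ('a \<Rightarrow> complex mat) set set \<Rightarrow> ('a \<Rightarrow> complex mat) set set" where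
  "irr_prod G A B = (\<Union>\<pi>\<in>A. \<Union>\<sigma>\<in>B. {\<rho> \<in> Irr G. irr_conv G \<pi> \<sigma> \<rho> \<noteq> 0})"

definition irr_haar :: "'a::topological_space monoid \<Rightarrow> ('a \<Rightarrow> complex mat) set measure" where
  "irr_haar G = point_measure (Irr G) (\<lambda>\<pi>. of_nat ((irr_dim G \<pi>)\<^sup>2))"

definition irr_leptin :: "'a::topological_space monoid \<Rightarrow> nat \<Rightarrow> bool" where
  "irr_leptin G D \<longleftrightarrow>
     (\<forall>K \<epsilon>. K \<subseteq> Irr G \<and> finite K \<and> (\<epsilon>::real) > 0 \<longrightarrow>
       (\<exists>V\<subseteq>Irr G. 0 < emeasure (irr_haar G) V \<and> emeasure (irr_haar G) V < \<infinity> \<and>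
          emeasure (irr_haar G) (irr_prod G K V) / emeasure (irr_haar G) V
            < of_nat D + ennreal \<epsilon>))"

end

theory Submission
  imports Defs "Jordan_Normal_Form.Spectral_Radius" "HOL-Library.Function_Algebras"
    "HOL-Real_Asymp.Real_Asymp"
begin

text \<open>
  For every monoid with a topology the condition holds already with $D = 1$. Let $V_0$ consist of the trivial class and
  put $V_{n+1} = K * V_n$. If no $V_n$ were a witness for $K$ and $\epsilon$, then $\lambda(V_n) \ge (1+\epsilon)^n$.
  But the matrix coefficients of the classes in $V_n$ lie in the span of the monomials of degree $n$ in the finitely
  many, say $N$, matrix coefficients of the classes in $K$. Matrix coefficients of pairwise inequivalent
  irreducible representations are linearly independent, so $\lambda(V_n) = \sum_{\pi \in V_n} d_\pi^2 \le (n+1)^N$,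
  which is a contradiction for large $n$.
\<close>

text \<open>Linear independence of matrix coefficients is usually read off from Schur orthogonality,
  that is, from integration over the group. Here it has to come from algebra alone: complex
  eigenvalues give Schur's lemma, and the adjoint of a unitary matrix does what the inverse of a
  group element would do, both for intertwiners and for splitting off an invariant subspace. The
  multiplicity in the definition of the product is a definite description. So before
  \<open>irr_prod\<close> says anything, a decomposition into irreducibles has to exist and its
  class counts have to be unique. Existence is complete reducibility; uniqueness uses the same
  independence, applied to traces. After that, one consequence of a nonzero multiplicity suffices:
  the coefficients of a constituent lie in the span of the coefficients of the tensor product, and
  these are products of coefficients of the factors. The weight d_\<pi>^2 is exactly the number of
  matrix coefficients of \<pi>, which turns the Haar measure into a dimension count; the same count
  shows that the sets V_n are finite.\<close>

no_notation vec_nth (infixl "$" 90)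

subsection \<open>Unitary matrices\<close>

lemma mat_adjoint_dim [simp]:
  "dim_row (mat_adjoint A) = dim_col A" "dim_col (mat_adjoint A) = dim_row A"
  by (auto simp: mat_adjoint_def mat_of_rows_def)

lemma mat_adjoint_carrier [simp, intro]:
  "A \<in> carrier_mat m n \<Longrightarrow> mat_adjoint A \<in> carrier_mat n m"
  by (auto intro!: carrier_matI)

lemma mat_adjoint_index [simp]:
  fixes A :: "complex mat"
  shows "i < dim_col A \<Longrightarrow> j < dim_row A \<Longrightarrow> mat_adjoint A $$ (i, j) = cnj (A $$ (j, i))"
  by (auto simp: mat_adjoint_def mat_of_rows_index)

lemma mat_mult_index:
  fixes A :: "'a::semiring_0 mat"
  assumes "A \<in> carrier_mat m n" "B \<in> carrier_mat n p" "i < m" "j < p"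
  shows "(A * B) $$ (i, j) = (\<Sum>k<n. A $$ (i, k) * B $$ (k, j))"
  using assms by (auto simp: scalar_prod_def lessThan_atLeast0)

lemma mat_adjoint_mult:
  fixes A :: "complex mat"
  assumes "A \<in> carrier_mat m n" "B \<in> carrier_mat n p"
  shows "mat_adjoint (A * B) = mat_adjoint B * mat_adjoint A"
proof (rule eq_matI)
  fix i j assume ij: "i < dim_row (mat_adjoint B * mat_adjoint A)" "j < dim_col (mat_adjoint B * mat_adjoint A)"
  then have "i < p" "j < m" using assms by auto
  then show "mat_adjoint (A * B) $$ (i, j) = (mat_adjoint B * mat_adjoint A) $$ (i, j)"
    using assms mat_mult_index[OF assms, of j i]
      mat_mult_index[of "mat_adjoint B" p n "mat_adjoint A" m i j]
    by (auto simp: mult.commute)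
qed (use assms in auto)

lemma mat_adjoint_adjoint [simp]:
  fixes A :: "complex mat"
  shows "mat_adjoint (mat_adjoint A) = A"
  by (rule eq_matI) auto

lemma mat_adjoint_one [simp]: "mat_adjoint (1\<^sub>m n :: complex mat) = 1\<^sub>m n"
  by (rule eq_matI) auto

lemma mat_adjoint_smult [simp]:
  fixes A :: "complex mat"
  shows "mat_adjoint (c \<cdot>\<^sub>m A) = cnj c \<cdot>\<^sub>m mat_adjoint A"
  by (rule eq_matI) auto

lemma mat_adjoint_zero [simp]: "mat_adjoint (0\<^sub>m m n :: complex mat) = 0\<^sub>m n m"
  by (rule eq_matI) auto

lemma mat_adjoint_four_block:
  fixes A :: "complex mat"
  assumes "A \<in> carrier_mat m n" "B \<in> carrier_mat m p" "C \<in> carrier_mat q n" "D \<in> carrier_mat q p"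
  shows "mat_adjoint (four_block_mat A B C D)
    = four_block_mat (mat_adjoint A) (mat_adjoint C) (mat_adjoint B) (mat_adjoint D)"
  using assms by (intro eq_matI) auto

text \<open>The diagonal entries of A* A are the squared norms of the columns of A.\<close>

lemma mat_adjoint_mult_self_eq_0:
  fixes A :: "complex mat"
  assumes A: "A \<in> carrier_mat m n" and z: "mat_adjoint A * A = 0\<^sub>m n n"
  shows "A = 0\<^sub>m m n"
proof (rule eq_matI)
  fix i j assume "i < dim_row (0\<^sub>m m n :: complex mat)" "j < dim_col (0\<^sub>m m n :: complex mat)"
  then have ij: "i < m" "j < n" by auto
  have "(\<Sum>k<m. complex_of_real ((cmod (A $$ (k, j)))\<^sup>2)) = (\<Sum>k<m. mat_adjoint A $$ (j, k) * A $$ (k, j))"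
  proof (intro sum.cong refl)
    fix k assume "k \<in> {..<m}"
    then have "mat_adjoint A $$ (j, k) = cnj (A $$ (k, j))" using A ij by auto
    then show "complex_of_real ((cmod (A $$ (k, j)))\<^sup>2) = mat_adjoint A $$ (j, k) * A $$ (k, j)"
      by (metis complex_norm_square mult.commute)
  qed
  also have "\<dots> = (mat_adjoint A * A) $$ (j, j)"
    using A ij by (subst mat_mult_index[of _ n m _ n]) auto
  finally have "(\<Sum>k<m. complex_of_real ((cmod (A $$ (k, j)))\<^sup>2)) = (mat_adjoint A * A) $$ (j, j)" .
  then have "(\<Sum>k<m. (cmod (A $$ (k, j)))\<^sup>2) = 0"
    unfolding z using ij by (simp only: of_real_sum[symmetric] index_zero_mat of_real_eq_0_iff)
  then have "\<forall>k\<in>{..<m}. (cmod (A $$ (k, j)))\<^sup>2 = 0"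
    by (subst (asm) sum_nonneg_eq_0_iff) auto
  then show "A $$ (i, j) = 0\<^sub>m m n $$ (i, j)" using ij by auto
qed (use A in auto)

text \<open>If n < k, zero rows below A and zero columns beside B make both square without changing
  the product B A. The left inverse is then a right inverse, which the zero row \<open>n\<close> of
  the padded A contradicts. All comparisons of dimensions below rest on this instead of on
  rank.\<close>

lemma left_inverse_dim_le:
  fixes A :: "'a::field mat"
  assumes A: "A \<in> carrier_mat n k" and B: "B \<in> carrier_mat k n" and BA: "B * A = 1\<^sub>m k"
  shows "k \<le> n"
proof (rule ccontr)
  assume "\<not> k \<le> n"
  then have nk: "n < k" by simp
  define A' where "A' = four_block_mat A (0\<^sub>m n 0) (0\<^sub>m (k - n) k) (0\<^sub>m (k - n) 0)"
  define B' where "B' = four_block_mat B (0\<^sub>m k (k - n)) (0\<^sub>m 0 n) (0\<^sub>m 0 (k - n))"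
  have car: "A' \<in> carrier_mat k k" "B' \<in> carrier_mat k k"
    using A B nk by (auto simp: A'_def B'_def)
  have "B' * A' = four_block_mat (1\<^sub>m k) (0\<^sub>m k 0) (0\<^sub>m 0 k) (0\<^sub>m 0 0)"
    unfolding A'_def B'_def using A B BA
    by (subst mult_four_block_mat[of _ k n _ "k - n" _ 0 _ _ k _ 0]) auto
  also have "\<dots> = 1\<^sub>m k" by (intro eq_matI) auto
  finally have "A' * B' = 1\<^sub>m k" using mat_mult_left_right_inverse[OF car(2,1)] by simp
  then have "(A' * B') $$ (n, n) = 1" using nk by simp
  moreover have "(A' * B') $$ (n, n) = 0"
    using nk A B by (subst mat_mult_index[OF car nk nk]) (auto simp: A'_def)
  ultimately show False by simp
qed

lemma unitary_group_carrier:
  "U \<in> carrier (unitary_group n) \<longleftrightarrow> U \<in> carrier_mat n n \<and> mat_adjoint U * U = 1\<^sub>m n"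
  by (auto simp: unitary_group_def)

lemma unitary_group_right:
  assumes "U \<in> carrier (unitary_group n)"
  shows "U * mat_adjoint U = 1\<^sub>m n"
  using assms mat_mult_left_right_inverse[of "mat_adjoint U" n U] by (auto simp: unitary_group_carrier)

lemma unitary_group_adjoint:
  assumes "U \<in> carrier (unitary_group n)"
  shows "mat_adjoint U \<in> carrier (unitary_group n)"
  using assms unitary_group_right[OF assms] by (auto simp: unitary_group_carrier)

lemma unitary_group_mult:
  assumes "U \<in> carrier (unitary_group n)" "V \<in> carrier (unitary_group n)"
  shows "U * V \<in> carrier (unitary_group n)"
proof -
  have c: "U \<in> carrier_mat n n" "V \<in> carrier_mat n n" "mat_adjoint U \<in> carrier_mat n n"
    "mat_adjoint V \<in> carrier_mat n n"
    using assms by (auto simp: unitary_group_carrier)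
  have "mat_adjoint (U * V) * (U * V) = mat_adjoint V * (mat_adjoint U * (U * V))"
    using c by (simp add: mat_adjoint_mult[OF c(1,2)] assoc_mult_mat[of _ n n _ n _ n])
  also have "mat_adjoint U * (U * V) = V"
    using assms c by (simp add: unitary_group_carrier flip: assoc_mult_mat[of _ n n _ n _ n])
  finally show ?thesis using assms c by (auto simp: unitary_group_carrier)
qed

lemma unitary_group_four_block:
  assumes "U \<in> carrier (unitary_group m)" "V \<in> carrier (unitary_group n)"
  shows "four_block_mat U (0\<^sub>m m n) (0\<^sub>m n m) V \<in> carrier (unitary_group (m + n))"
proof -
  have c: "U \<in> carrier_mat m m" "V \<in> carrier_mat n n" using assms by (auto simp: unitary_group_carrier)
  show ?thesis using assms c
    unfolding unitary_group_carrier
    by (subst mat_adjoint_four_block[of _ m m _ n _ n], (auto)[4],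
        subst mult_four_block_mat[of _ m m _ n _ n _ _ m _ n]) auto
qed

text \<open>This replaces the invariance of the orthogonal complement, whose usual proof needs
  inverses of group elements. The upper left block of U* U = 1 makes A unitary; that of U U* = 1
  then leaves B B* = 0.\<close>

lemma unitary_block_triangular:
  assumes A: "A \<in> carrier_mat m m" and B: "B \<in> carrier_mat m n" and D: "D \<in> carrier_mat n n"
    and U: "four_block_mat A B (0\<^sub>m n m) D \<in> carrier (unitary_group (m + n))"
  shows "B = 0\<^sub>m m n" "A \<in> carrier (unitary_group m)" "D \<in> carrier (unitary_group n)"
proof -
  note adj = mat_adjoint_four_block[OF A B zero_carrier_mat D]
  have c: "mat_adjoint A * A \<in> carrier_mat m m" "mat_adjoint A * B \<in> carrier_mat m n"
    "mat_adjoint B * A \<in> carrier_mat n m" "D * mat_adjoint D \<in> carrier_mat n n"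
    "B * mat_adjoint D \<in> carrier_mat m n" "D * mat_adjoint B \<in> carrier_mat n m"
    using A B D by auto
  have 1: "1\<^sub>m (m + n) = four_block_mat (mat_adjoint A * A) (mat_adjoint A * B) (mat_adjoint B * A)
      (mat_adjoint B * B + mat_adjoint D * D)"
    using U A B D c unfolding unitary_group_carrier adj
    by (subst (asm) mult_four_block_mat[of _ m m _ n _ n _ _ m _ n]) auto
  have 2: "1\<^sub>m (m + n) = four_block_mat (A * mat_adjoint A + B * mat_adjoint B) (B * mat_adjoint D)
      (D * mat_adjoint B) (D * mat_adjoint D)"
    using unitary_group_right[OF U] A B D c unfolding adj
    by (subst (asm) mult_four_block_mat[of _ m m _ n _ n _ _ m _ n]) auto
  have AA: "mat_adjoint A * A = 1\<^sub>m m"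
  proof (rule eq_matI)
    fix i j assume "i < dim_row (1\<^sub>m m :: complex mat)" "j < dim_col (1\<^sub>m m :: complex mat)"
    then show "(mat_adjoint A * A) $$ (i, j) = 1\<^sub>m m $$ (i, j)"
      using arg_cong[OF 1, of "\<lambda>M. M $$ (i, j)"] A by (simp del: index_mult_mat(1))
  qed (use A in auto)
  then have UA: "A \<in> carrier (unitary_group m)" using A by (simp add: unitary_group_carrier)
  \<comment> \<open>A is square, so A* A = 1 gives A A* = 1, and the upper left block A A* + B B* of
    U U* becomes 1 + B B*.\<close>
  have AB: "1\<^sub>m m + B * mat_adjoint B = 1\<^sub>m m"
  proof (rule eq_matI)
    fix i j assume "i < dim_row (1\<^sub>m m :: complex mat)" "j < dim_col (1\<^sub>m m :: complex mat)"
    then have ij: "i < m" "j < m" by auto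
    have "(1\<^sub>m (m + n) :: complex mat) $$ (i, j) = (A * mat_adjoint A + B * mat_adjoint B) $$ (i, j)"
      unfolding 2 using A B ij by (subst index_mat_four_block) auto
    then show "(1\<^sub>m m + B * mat_adjoint B) $$ (i, j) = 1\<^sub>m m $$ (i, j)"
      using ij unfolding unitary_group_right[OF UA] by simp
  qed (use B in auto)
  have "B * mat_adjoint B = 0\<^sub>m m m"
  proof (rule eq_matI)
    fix i j assume "i < dim_row (0\<^sub>m m m :: complex mat)" "j < dim_col (0\<^sub>m m m :: complex mat)"
    then have ij: "i < m" "j < m" by auto
    have "(1\<^sub>m m + B * mat_adjoint B) $$ (i, j) = 1\<^sub>m m $$ (i, j) + (B * mat_adjoint B) $$ (i, j)"
      using B ij by (subst index_add_mat) auto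
    then show "(B * mat_adjoint B) $$ (i, j) = 0\<^sub>m m m $$ (i, j)"
      using ij unfolding AB by simp
  qed (use B in auto)
  then have "mat_adjoint B = 0\<^sub>m n m"
    using B by (intro mat_adjoint_mult_self_eq_0[of _ n m]) simp_all
  then show B0: "B = 0\<^sub>m m n" by (metis mat_adjoint_adjoint mat_adjoint_zero)
  show "A \<in> carrier (unitary_group m)" by fact
  have "mat_adjoint D * D = 1\<^sub>m n"
  proof (rule eq_matI)
    fix i j assume "i < dim_row (1\<^sub>m n :: complex mat)" "j < dim_col (1\<^sub>m n :: complex mat)"
    then show "(mat_adjoint D * D) $$ (i, j) = 1\<^sub>m n $$ (i, j)"
      using arg_cong[OF 1, of "\<lambda>M. M $$ (m + i, m + j)"] A D B0 by (simp del: index_mult_mat(1))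
  qed (use D in auto)
  then show "D \<in> carrier (unitary_group n)" using D by (simp add: unitary_group_carrier)
qed

subsection \<open>Orthonormal families\<close>

abbreviation vec_subspace :: "nat \<Rightarrow> complex vec set \<Rightarrow> bool" where
  "vec_subspace n W \<equiv> VectorSpace.subspace class_ring W (module_vec TYPE(complex) n)"

lemma vec_subspace_iff:
  "vec_subspace n W \<longleftrightarrow> W \<subseteq> carrier_vec n \<and> 0\<^sub>v n \<in> W \<and>
     (\<forall>v\<in>W. \<forall>w\<in>W. v + w \<in> W) \<and> (\<forall>c. \<forall>v\<in>W. c \<cdot>\<^sub>v v \<in> W)"
  using vec_vs[of n] vec_module[of n]
  by (auto simp: VectorSpace.subspace_def submodule_def module_vec_simps)

lemma mult_unit_vec:
  fixes A :: "'a::semiring_1 mat"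
  assumes "A \<in> carrier_mat m n" "j < n"
  shows "A *\<^sub>v unit_vec n j = col A j"
  using assms by (intro eq_vecI) (auto simp: scalar_prod_right_unit[of _ n])

lemma cscalar_prod_sum:
  fixes v w :: "complex vec"
  assumes "w \<in> carrier_vec n"
  shows "v \<bullet>c w = (\<Sum>i<n. v $ i * cnj (w $ i))"
  using assms by (auto simp: scalar_prod_def lessThan_atLeast0)

lemma cscalar_prod_self:
  fixes w :: "complex vec"
  assumes w: "w \<in> carrier_vec n" and w0: "w \<noteq> 0\<^sub>v n"
  obtains r :: real where "r > 0" "w \<bullet>c w = complex_of_real r"
proof -
  have "w \<bullet>c w = (\<Sum>i<n. complex_of_real ((cmod (w $ i))\<^sup>2))"
    unfolding cscalar_prod_sum[OF w] complex_norm_square ..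
  then have eq: "w \<bullet>c w = complex_of_real (\<Sum>i<n. (cmod (w $ i))\<^sup>2)"
    unfolding of_real_sum .
  obtain i where i: "i < n" "w $ i \<noteq> 0"
    using w w0 by (metis carrier_vecD eq_vecI index_zero_vec(1) zero_carrier_vec)
  have "(\<Sum>i<n. (cmod (w $ i))\<^sup>2) > 0"
    by (rule sum_pos2[of _ i]) (use i in auto)
  then show ?thesis using that eq by blast
qed

text \<open>Only the values below \<open>k\<close> matter, so a family is extended by a function
  update at \<open>k\<close>.\<close>

definition orthonormal_family :: "nat \<Rightarrow> nat \<Rightarrow> (nat \<Rightarrow> complex vec) \<Rightarrow> bool" where
  "orthonormal_family n k u \<longleftrightarrow> (\<forall>i<k. u i \<in> carrier_vec n) \<and>
     (\<forall>i<k. \<forall>j<k. u i \<bullet>c u j = (if i = j then 1 else 0))"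

lemma orthonormal_family_mat:
  assumes "orthonormal_family n k u"
  defines "M \<equiv> Matrix.mat n k (\<lambda>(i, j). u j $ i)"
  shows "mat_adjoint M * M = 1\<^sub>m k"
proof (rule eq_matI)
  fix i j assume "i < dim_row (1\<^sub>m k :: complex mat)" "j < dim_col (1\<^sub>m k :: complex mat)"
  then have ij: "i < k" "j < k" by auto
  have M: "M \<in> carrier_mat n k" by (auto simp: M_def)
  have "(mat_adjoint M * M) $$ (i, j) = (\<Sum>l<n. mat_adjoint M $$ (i, l) * M $$ (l, j))"
    by (rule mat_mult_index[OF _ M ij]) (use M in auto)
  also have "\<dots> = (\<Sum>l<n. u j $ l * cnj (u i $ l))"
    using ij by (intro sum.cong) (auto simp: M_def)
  also have "\<dots> = u j \<bullet>c u i"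
    using assms(1) ij cscalar_prod_sum[of "u i" n "u j"] by (auto simp: orthonormal_family_def)
  also have "\<dots> = 1\<^sub>m k $$ (i, j)" using assms(1) ij by (auto simp: orthonormal_family_def)
  finally show "(mat_adjoint M * M) $$ (i, j) = 1\<^sub>m k $$ (i, j)" .
qed (auto simp: M_def)

lemma orthonormal_family_le:
  assumes "orthonormal_family n k u"
  shows "k \<le> n"
  by (rule left_inverse_dim_le[OF _ _ orthonormal_family_mat[OF assms]]) auto

text \<open>As long as some nonzero w in W is orthogonal to the family, its normalisation is
  appended; \<open>orthonormal_family_le\<close> bounds the length, so \<open>n - k\<close>
  decreases. Maximality stands in for a basis of W, and keeping the first \<open>k\<close> members
  allows a second extension from W to the whole space.\<close>

lemma orthonormal_family_maximal:
  assumes "vec_subspace n W" "orthonormal_family n k u" "\<forall>i<k. u i \<in> W"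
  shows "\<exists>u' k'. k \<le> k' \<and> (\<forall>i<k. u' i = u i) \<and> orthonormal_family n k' u' \<and> (\<forall>i<k'. u' i \<in> W) \<and>
    (\<forall>w\<in>W. (\<forall>i<k'. w \<bullet>c u' i = 0) \<longrightarrow> w = 0\<^sub>v n)"
  using assms(2,3)
proof (induction "n - k" arbitrary: k u rule: less_induct)
  case less
  show ?case
  proof (cases "\<forall>w\<in>W. (\<forall>i<k. w \<bullet>c u i = 0) \<longrightarrow> w = 0\<^sub>v n")
    case True
    then show ?thesis using less.prems by (intro exI[of _ u] exI[of _ k]) auto
  next
    case False
    then obtain w where w: "w \<in> W" "\<And>i. i < k \<Longrightarrow> w \<bullet>c u i = 0" "w \<noteq> 0\<^sub>v n" by blast
    have wn: "w \<in> carrier_vec n" using w(1) assms(1) by (auto simp: vec_subspace_iff)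
    obtain r where r: "r > 0" "w \<bullet>c w = complex_of_real r" using cscalar_prod_self[OF wn w(3)] .
    define c where "c = complex_of_real (1 / sqrt r)"
    define w' where "w' = c \<cdot>\<^sub>v w"
    have w'n: "w' \<in> carrier_vec n" using wn by (simp add: w'_def)
    have w'W: "w' \<in> W" using w(1) assms(1) by (auto simp: vec_subspace_iff w'_def)
    have un: "\<And>i. i < k \<Longrightarrow> u i \<in> carrier_vec n"
      and uu: "\<And>i j. i < k \<Longrightarrow> j < k \<Longrightarrow> u i \<bullet>c u j = (if i = j then 1 else 0)"
      using less.prems by (auto simp: orthonormal_family_def)
    have w'u: "w' \<bullet>c u i = 0" if "i < k" for i
    proof -
      have "w' \<bullet>c u i = c * (w \<bullet>c u i)"
        using wn un[OF that] by (simp add: w'_def cscalar_prod_sum[OF un[OF that]] sum_distrib_left mult.assoc)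
      then show ?thesis using w(2)[OF that] by simp
    qed
    have uw': "u i \<bullet>c w' = 0" if "i < k" for i
    proof -
      have "cnj (w' \<bullet>c u i) = u i \<bullet>c w'"
        unfolding cscalar_prod_sum[OF un[OF that]] cscalar_prod_sum[OF w'n] by (simp add: mult.commute)
      then show ?thesis using w'u[OF that] by simp
    qed
    have w'w': "w' \<bullet>c w' = 1"
    proof -
      have "w' \<bullet>c w' = (c * cnj c) * (w \<bullet>c w)"
        unfolding cscalar_prod_sum[OF w'n] cscalar_prod_sum[OF wn]
        using wn by (simp add: w'_def sum_distrib_left mult_ac)
      also have "c * cnj c = complex_of_real (1 / r)"
        using r by (simp add: c_def flip: of_real_mult)
      finally show ?thesis using r by simp
    qed
    have on: "orthonormal_family n (Suc k) (u(k := w'))"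
      unfolding orthonormal_family_def less_Suc_eq using un uu w'n w'u uw' w'w' by auto
    moreover have inW: "\<forall>i<Suc k. (u(k := w')) i \<in> W"
      using less.prems w'W by (auto simp: less_Suc_eq)
    moreover have "n - Suc k < n - k" using orthonormal_family_le[OF on] by simp
    ultimately obtain u' k' where "Suc k \<le> k'" "\<forall>i<Suc k. u' i = (u(k := w')) i"
      "orthonormal_family n k' u'" "\<forall>i<k'. u' i \<in> W"
      "\<forall>w\<in>W. (\<forall>i<k'. w \<bullet>c u' i = 0) \<longrightarrow> w = 0\<^sub>v n"
      using less.hyps[of "Suc k" "u(k := w')"] by auto
    then show ?thesis by (intro exI[of _ u'] exI[of _ k']) auto
  qed
qed

text \<open>Gram--Schmidt, one family member at a time.\<close>
lemma orthonormal_family_residual: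
  assumes W: "vec_subspace n W" and u: "orthonormal_family n N u" and uW: "\<forall>i<k. u i \<in> W"
    and "k \<le> N" "w \<in> W" "m \<le> k"
  shows "\<exists>r\<in>W. \<forall>j<N. r \<bullet>c u j = (if j < m then 0 else w \<bullet>c u j)"
  using \<open>m \<le> k\<close>
proof (induction m)
  case 0
  then show ?case using \<open>w \<in> W\<close> by auto
next
  case (Suc m)
  then obtain r where r: "r \<in> W" "\<And>j. j < N \<Longrightarrow> r \<bullet>c u j = (if j < m then 0 else w \<bullet>c u j)" by auto
  define r' where "r' = r + (- (w \<bullet>c u m)) \<cdot>\<^sub>v u m"
  have m: "m < k" "m < N" using Suc.prems \<open>k \<le> N\<close> by auto
  have un: "\<And>i. i < N \<Longrightarrow> u i \<in> carrier_vec n"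
    and uu: "\<And>i j. i < N \<Longrightarrow> j < N \<Longrightarrow> u i \<bullet>c u j = (if i = j then 1 else 0)"
    using u by (auto simp: orthonormal_family_def)
  have rn: "r \<in> carrier_vec n" using r(1) W by (auto simp: vec_subspace_iff)
  have "r' \<bullet>c u j = (if j < Suc m then 0 else w \<bullet>c u j)" if j: "j < N" for j
  proof -
    have "r' \<bullet>c u j = r \<bullet>c u j - (w \<bullet>c u m) * (u m \<bullet>c u j)"
      using rn un[OF m(2)] unfolding r'_def cscalar_prod_sum[OF un[OF j]]
      by (simp add: algebra_simps sum.distrib sum_distrib_left sum_subtractf sum_negf)
    then show ?thesis using r(2)[OF j] uu[OF m(2) j] by (cases "j = m") auto
  qed
  moreover have "r' \<in> W" using r(1) W uW m unfolding r'_def vec_subspace_iff by blast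
  ultimately show ?case by blast
qed

text \<open>A family maximal in W is extended to one maximal in the whole space, and the result
  gives the columns of U. The later columns are orthogonal to W: subtracting from w its components
  along the first k columns leaves an element of W orthogonal to all of these, which is 0 by
  maximality, while its products with the later columns have not changed.\<close>

lemma exists_adapted_unitary:
  assumes W: "vec_subspace n W"
  obtains U k where "U \<in> carrier (unitary_group n)" "k \<le> n" "\<And>j. j < k \<Longrightarrow> col U j \<in> W"
    "\<And>w j. w \<in> W \<Longrightarrow> k \<le> j \<Longrightarrow> j < n \<Longrightarrow> w \<bullet>c col U j = 0"
proof -
  obtain u k where u: "orthonormal_family n k u" "\<forall>i<k. u i \<in> W"
    "\<forall>w\<in>W. (\<forall>i<k. w \<bullet>c u i = 0) \<longrightarrow> w = 0\<^sub>v n"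
    using orthonormal_family_maximal[OF W, of 0] by (auto simp: orthonormal_family_def)
  have "vec_subspace n (carrier_vec n)" by (auto simp: vec_subspace_iff)
  from orthonormal_family_maximal[OF this u(1)] u(1) obtain v N where
    v: "k \<le> N" "\<forall>i<k. v i = u i" "orthonormal_family n N v"
    "\<forall>w\<in>carrier_vec n. (\<forall>i<N. w \<bullet>c v i = 0) \<longrightarrow> w = 0\<^sub>v n"
    by (auto simp: orthonormal_family_def)
  have vn: "\<And>i. i < N \<Longrightarrow> v i \<in> carrier_vec n" using v by (auto simp: orthonormal_family_def)
  define U where "U = Matrix.mat n N (\<lambda>(i, j). v j $ i)"
  have U: "U \<in> carrier_mat n N" by (simp add: U_def)
  have UU: "mat_adjoint U * U = 1\<^sub>m N" unfolding U_def by (rule orthonormal_family_mat[OF v(3)])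
  have colU: "col U j = v j" if "j < N" for j
    using that vn[OF that] by (intro eq_vecI) (auto simp: U_def)
  have adjU: "(mat_adjoint U *\<^sub>v w) $ j = w \<bullet>c v j" if "j < N" "w \<in> carrier_vec n" for j w
    unfolding cscalar_prod_sum[OF vn[OF that(1)]] using that U
    by (auto simp: scalar_prod_def U_def lessThan_atLeast0 mult.commute intro!: sum.cong)
  \<comment> \<open>The residual of w is orthogonal to every member of v, hence 0 by maximality.
    This gives U U* = 1, so U is square although the length N was not known to be n.\<close>
  have fix_vec: "U *\<^sub>v (mat_adjoint U *\<^sub>v w) = w" if w: "w \<in> carrier_vec n" for w
  proof -
    let ?r = "w - U *\<^sub>v (mat_adjoint U *\<^sub>v w)"
    have c: "mat_adjoint U \<in> carrier_mat N n" using U by simp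
    have aU: "mat_adjoint U *\<^sub>v w \<in> carrier_vec N" by (rule mult_mat_vec_carrier[OF c w])
    have UaU: "U *\<^sub>v (mat_adjoint U *\<^sub>v w) \<in> carrier_vec n" by (rule mult_mat_vec_carrier[OF U aU])
    have r: "?r \<in> carrier_vec n" using w UaU by (rule minus_carrier_vec)
    have "mat_adjoint U *\<^sub>v (U *\<^sub>v (mat_adjoint U *\<^sub>v w)) = mat_adjoint U *\<^sub>v w"
      using UU aU U c by (metis assoc_mult_mat_vec one_mult_mat_vec)
    then have "mat_adjoint U *\<^sub>v ?r = 0\<^sub>v N"
      using aU by (simp add: mult_minus_distrib_mat_vec[OF c w UaU])
    then have "\<forall>i<N. ?r \<bullet>c v i = 0"
      using adjU[OF _ r] by (metis index_zero_vec(1))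
    then have "?r = 0\<^sub>v n" using v(4) r by blast
    show ?thesis
    proof (rule eq_vecI)
      fix i assume "i < dim_vec w"
      then have "(w - U *\<^sub>v (mat_adjoint U *\<^sub>v w)) $ i = w $ i - (U *\<^sub>v (mat_adjoint U *\<^sub>v w)) $ i"
        using w UaU by (intro index_minus_vec) (metis carrier_vecD)
      then show "(U *\<^sub>v (mat_adjoint U *\<^sub>v w)) $ i = w $ i"
        using \<open>?r = 0\<^sub>v n\<close> \<open>i < dim_vec w\<close> w by simp
    qed (use w U in auto)
  qed
  have "U * mat_adjoint U = 1\<^sub>m n"
  proof (rule eq_matI)
    fix i j assume "i < dim_row (1\<^sub>m n :: complex mat)" "j < dim_col (1\<^sub>m n :: complex mat)"
    then have ij: "i < n" "j < n" by auto
    have "(U * mat_adjoint U) *\<^sub>v unit_vec n j = unit_vec n j"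
      using fix_vec[of "unit_vec n j"] U by (subst assoc_mult_mat_vec[of _ n N _ n]) auto
    then have "col (U * mat_adjoint U) j = unit_vec n j"
      using ij U by (simp add: mult_unit_vec[of _ n n])
    then show "(U * mat_adjoint U) $$ (i, j) = 1\<^sub>m n $$ (i, j)"
      using ij U by (metis (no_types, lifting) carrier_matD index_col index_mult_mat(2,3) col_one index_one_mat(2,3) mat_adjoint_dim(2))
  qed (use U in auto)
  then have "n \<le> N" using left_inverse_dim_le[of "mat_adjoint U" N n U] U by auto
  then have N: "N = n" using orthonormal_family_le[OF v(3)] by simp
  show ?thesis
  proof (rule that[of U k])
    show "U \<in> carrier (unitary_group n)" using U UU N by (auto simp: unitary_group_carrier)
    show "k \<le> n" using v(1) N by simp
    show "col U j \<in> W" if "j < k" for j using that u(2) v(1,2) by (simp add: colU)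
    show "w \<bullet>c col U j = 0" if "w \<in> W" "k \<le> j" "j < n" for w j
    proof -
      note wW = that(1)
      obtain r where r: "r \<in> W" "\<And>j. j < N \<Longrightarrow> r \<bullet>c v j = (if j < k then 0 else w \<bullet>c v j)"
        using orthonormal_family_residual[OF W v(3) _ v(1) wW order_refl] u(2) v(2) by metis
      have "\<forall>i<k. r \<bullet>c u i = 0" using r(2) v(1,2) by (metis order_less_le_trans)
      then have "r = 0\<^sub>v n" using u(3) r(1) by blast
      then have "r \<bullet>c v j = 0" using vn[of j] that N by (simp add: cscalar_prod_sum)
      then show ?thesis using r(2)[of j] that N by (simp add: colU)
    qed
  qed
qed

subsection \<open>Unitary representations\<close>

text \<open>Membership in \<open>hom\<close> only means multiplicativity, so the value at the
  identity must be derived: it is idempotent and unitary, and cancelling with its adjoint leaves the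
  identity matrix.\<close>

lemma unitary_repD:
  assumes "Group.monoid G" "unitary_rep G \<rho>"
  shows unitary_rep_unitary: "g \<in> carrier G \<Longrightarrow> \<rho> g \<in> carrier (unitary_group (rep_dim G \<rho>))"
    and unitary_rep_carrier: "g \<in> carrier G \<Longrightarrow> \<rho> g \<in> carrier_mat (rep_dim G \<rho>) (rep_dim G \<rho>)"
    and unitary_rep_mult: "g \<in> carrier G \<Longrightarrow> h \<in> carrier G \<Longrightarrow> \<rho> (g \<otimes>\<^bsub>G\<^esub> h) = \<rho> g * \<rho> h"
    and unitary_rep_one: "\<rho> \<one>\<^bsub>G\<^esub> = 1\<^sub>m (rep_dim G \<rho>)"
    and unitary_rep_continuous: "i < rep_dim G \<rho> \<Longrightarrow> j < rep_dim G \<rho> \<Longrightarrow>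
      continuous_on (carrier G) (\<lambda>g. \<rho> g $$ (i, j))"
proof -
  let ?n = "rep_dim G \<rho>"
  interpret Group.monoid G by fact
  show U: "g \<in> carrier G \<Longrightarrow> \<rho> g \<in> carrier (unitary_group ?n)" for g
    using assms(2) by (auto simp: unitary_rep_def hom_def)
  show C: "g \<in> carrier G \<Longrightarrow> \<rho> g \<in> carrier_mat ?n ?n" for g
    using U by (auto simp: unitary_group_carrier)
  show M: "g \<in> carrier G \<Longrightarrow> h \<in> carrier G \<Longrightarrow> \<rho> (g \<otimes>\<^bsub>G\<^esub> h) = \<rho> g * \<rho> h" for g h
    using assms(2) by (auto simp: unitary_rep_def hom_def unitary_group_def)
  have one: "\<one>\<^bsub>G\<^esub> \<in> carrier G" by simp
  have c: "\<rho> \<one>\<^bsub>G\<^esub> \<in> carrier_mat ?n ?n" "mat_adjoint (\<rho> \<one>\<^bsub>G\<^esub>) \<in> carrier_mat ?n ?n"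
    using C[OF one] by auto
  have u: "mat_adjoint (\<rho> \<one>\<^bsub>G\<^esub>) * \<rho> \<one>\<^bsub>G\<^esub> = 1\<^sub>m ?n"
    using U[OF one] by (auto simp: unitary_group_carrier)
  have "\<rho> \<one>\<^bsub>G\<^esub> = (mat_adjoint (\<rho> \<one>\<^bsub>G\<^esub>) * \<rho> \<one>\<^bsub>G\<^esub>) * \<rho> \<one>\<^bsub>G\<^esub>"
    unfolding u using c by simp
  also have "\<dots> = mat_adjoint (\<rho> \<one>\<^bsub>G\<^esub>) * (\<rho> \<one>\<^bsub>G\<^esub> * \<rho> \<one>\<^bsub>G\<^esub>)"
    using c by (simp add: assoc_mult_mat[of _ ?n ?n _ ?n _ ?n])
  also have "\<rho> \<one>\<^bsub>G\<^esub> * \<rho> \<one>\<^bsub>G\<^esub> = \<rho> \<one>\<^bsub>G\<^esub>"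
    using M[OF one one] by simp
  finally show "\<rho> \<one>\<^bsub>G\<^esub> = 1\<^sub>m ?n" using u by simp
  show "i < ?n \<Longrightarrow> j < ?n \<Longrightarrow> continuous_on (carrier G) (\<lambda>g. \<rho> g $$ (i, j))"
    using assms(2) by (auto simp: unitary_rep_def)
qed

lemma unitary_repI:
  assumes "Group.monoid G"
    and "\<And>g. g \<in> carrier G \<Longrightarrow> \<rho> g \<in> carrier (unitary_group n)"
    and "\<And>g h. g \<in> carrier G \<Longrightarrow> h \<in> carrier G \<Longrightarrow> \<rho> (g \<otimes>\<^bsub>G\<^esub> h) = \<rho> g * \<rho> h"
    and "\<And>i j. i < n \<Longrightarrow> j < n \<Longrightarrow> continuous_on (carrier G) (\<lambda>g. \<rho> g $$ (i, j))"
  shows "unitary_rep G \<rho>" "rep_dim G \<rho> = n"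
proof -
  interpret Group.monoid G by fact
  show d: "rep_dim G \<rho> = n"
    using assms(2)[of "\<one>\<^bsub>G\<^esub>"] by (auto simp: rep_dim_def unitary_group_carrier)
  show "unitary_rep G \<rho>"
    unfolding unitary_rep_def d hom_def using assms by (auto simp: unitary_group_def)
qed

lemma rep_equivE:
  assumes "rep_equiv G \<rho> \<sigma>"
  obtains U where "U \<in> carrier (unitary_group (rep_dim G \<rho>))"
    "\<And>g. g \<in> carrier G \<Longrightarrow> U * \<rho> g = \<sigma> g * U" "rep_dim G \<sigma> = rep_dim G \<rho>"
  using assms unfolding rep_equiv_def by metis

lemma rep_equiv_refl:
  assumes "Group.monoid G" "unitary_rep G \<rho>"
  shows "rep_equiv G \<rho> \<rho>"
proof -
  have "1\<^sub>m (rep_dim G \<rho>) * \<rho> g = \<rho> g * 1\<^sub>m (rep_dim G \<rho>)" if "g \<in> carrier G" for g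
    using unitary_rep_carrier[OF assms that] by simp
  then show ?thesis
    unfolding rep_equiv_def by (auto intro!: bexI[of _ "1\<^sub>m (rep_dim G \<rho>)"] simp: unitary_group_carrier)
qed

lemma rep_equiv_sym:
  assumes "\<And>g. g \<in> carrier G \<Longrightarrow> \<rho> g \<in> carrier_mat (rep_dim G \<rho>) (rep_dim G \<rho>)"
    and "\<And>g. g \<in> carrier G \<Longrightarrow> \<sigma> g \<in> carrier_mat (rep_dim G \<sigma>) (rep_dim G \<sigma>)"
    and "rep_equiv G \<rho> \<sigma>"
  shows "rep_equiv G \<sigma> \<rho>"
proof -
  let ?n = "rep_dim G \<rho>"
  from assms(3) obtain U where U: "U \<in> carrier (unitary_group ?n)"
    "\<And>g. g \<in> carrier G \<Longrightarrow> U * \<rho> g = \<sigma> g * U" and n: "rep_dim G \<sigma> = ?n"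
    by (rule rep_equivE) blast
  have c: "U \<in> carrier_mat ?n ?n" "mat_adjoint U \<in> carrier_mat ?n ?n"
    and u: "mat_adjoint U * U = 1\<^sub>m ?n"
    using U by (auto simp: unitary_group_carrier)
  have "mat_adjoint U * \<sigma> g = \<rho> g * mat_adjoint U" if g: "g \<in> carrier G" for g
  proof -
    note cc = c assms(1)[OF g] assms(2)[OF g, unfolded n]
    note a = assoc_mult_mat[of _ ?n ?n _ ?n _ ?n]
    have "mat_adjoint U * \<sigma> g = mat_adjoint U * \<sigma> g * (U * mat_adjoint U)"
      using cc by (simp add: unitary_group_right[OF U(1)] del: assoc_mult_mat)
    also have "\<dots> = mat_adjoint U * (\<sigma> g * U) * mat_adjoint U"
      using cc by (simp add: a)
    also have "\<dots> = (mat_adjoint U * U) * \<rho> g * mat_adjoint U"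
      unfolding U(2)[OF g, symmetric] using cc by (simp add: a)
    also have "\<dots> = \<rho> g * mat_adjoint U" unfolding u using cc by simp
    finally show ?thesis .
  qed
  then show ?thesis
    unfolding rep_equiv_def n using unitary_group_adjoint[OF U(1)] by auto
qed

text \<open>The assumptions are only that the values are square of the right size, since complete
  reducibility applies this to block sums that have not been shown to be unitary
  representations.\<close>

lemma rep_equiv_trans:
  assumes "\<And>g. g \<in> carrier G \<Longrightarrow> \<rho> g \<in> carrier_mat (rep_dim G \<rho>) (rep_dim G \<rho>)"
    and "\<And>g. g \<in> carrier G \<Longrightarrow> \<sigma> g \<in> carrier_mat (rep_dim G \<sigma>) (rep_dim G \<sigma>)"
    and "\<And>g. g \<in> carrier G \<Longrightarrow> \<tau> g \<in> carrier_mat (rep_dim G \<tau>) (rep_dim G \<tau>)"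
    and "rep_equiv G \<rho> \<sigma>" "rep_equiv G \<sigma> \<tau>"
  shows "rep_equiv G \<rho> \<tau>"
proof -
  let ?n = "rep_dim G \<rho>"
  from assms(4) obtain U where U: "U \<in> carrier (unitary_group ?n)"
    "\<And>g. g \<in> carrier G \<Longrightarrow> U * \<rho> g = \<sigma> g * U" and n: "rep_dim G \<sigma> = ?n"
    by (rule rep_equivE) blast
  from assms(5) obtain V where V: "V \<in> carrier (unitary_group ?n)"
    "\<And>g. g \<in> carrier G \<Longrightarrow> V * \<sigma> g = \<tau> g * V" and m: "rep_dim G \<tau> = ?n"
    unfolding n[symmetric] by (rule rep_equivE) blast
  have c: "U \<in> carrier_mat ?n ?n" "V \<in> carrier_mat ?n ?n"
    using U V by (auto simp: unitary_group_carrier)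
  have "(V * U) * \<rho> g = \<tau> g * (V * U)" if g: "g \<in> carrier G" for g
  proof -
    note cc = c assms(1)[OF g] assms(2)[OF g, unfolded n] assms(3)[OF g, unfolded m]
    note a = assoc_mult_mat[of _ ?n ?n _ ?n _ ?n]
    have "(V * U) * \<rho> g = V * (\<sigma> g * U)" using cc by (simp add: a U(2)[OF g])
    also have "\<dots> = (V * \<sigma> g) * U" using cc by (simp add: a)
    also have "\<dots> = \<tau> g * (V * U)" unfolding V(2)[OF g] using cc by (simp add: a)
    finally show ?thesis .
  qed
  then show ?thesis
    unfolding rep_equiv_def m using unitary_group_mult[OF V(1) U(1)] by auto
qed

subsection \<open>Schur's lemma\<close>

text \<open>T has a complex eigenvalue; its eigenspace is nonzero and, as T commutes with \<rho>,
  invariant, so it is the whole space.\<close>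

lemma irreducible_commutant_scalar:
  assumes G: "Group.monoid G" and \<rho>: "\<rho> \<in> irreps G"
    and T: "T \<in> carrier_mat (rep_dim G \<rho>) (rep_dim G \<rho>)"
    and comm: "\<And>g. g \<in> carrier G \<Longrightarrow> T * \<rho> g = \<rho> g * T"
  obtains c where "T = c \<cdot>\<^sub>m 1\<^sub>m (rep_dim G \<rho>)"
proof -
  define n where "n = rep_dim G \<rho>"
  note T = T[folded n_def]
  have u: "unitary_rep G \<rho>" and irr: "irreducible_rep G \<rho>" and n: "n > 0"
    using \<rho> by (auto simp: irreps_def irreducible_rep_def Let_def n_def)
  note car = unitary_rep_carrier[OF G u, folded n_def]
  from spectrum_non_empty[OF T n] obtain c where "eigenvalue T c" by (auto simp: spectrum_def)
  then obtain v where v: "v \<in> carrier_vec n" "v \<noteq> 0\<^sub>v n" "T *\<^sub>v v = c \<cdot>\<^sub>v v"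
    using T by (auto simp: eigenvalue_def eigenvector_def)
  define W where "W = {v \<in> carrier_vec n. T *\<^sub>v v = c \<cdot>\<^sub>v v}"
  have "vec_subspace n W"
    unfolding vec_subspace_iff W_def
    using T by (auto simp: mult_add_distrib_mat_vec smult_add_distrib_vec mult_mat_vec smult_smult_assoc mult.commute)
  moreover have "\<rho> g *\<^sub>v w \<in> W" if g: "g \<in> carrier G" and w: "w \<in> W" for g w
  proof -
    have wn: "w \<in> carrier_vec n" "T *\<^sub>v w = c \<cdot>\<^sub>v w" using w by (auto simp: W_def)
    have "T *\<^sub>v (\<rho> g *\<^sub>v w) = (T * \<rho> g) *\<^sub>v w" using T car[OF g] wn by simp
    also have "\<dots> = \<rho> g *\<^sub>v (T *\<^sub>v w)" unfolding comm[OF g] using T car[OF g] wn by simp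
    also have "\<dots> = c \<cdot>\<^sub>v (\<rho> g *\<^sub>v w)" unfolding wn(2) using car[OF g] wn by (simp add: mult_mat_vec)
    finally show ?thesis using car[OF g] wn by (auto simp: W_def)
  qed
  ultimately have "W = {0\<^sub>v n} \<or> W = carrier_vec n"
    using irr by (auto simp: irreducible_rep_def Let_def n_def[symmetric])
  moreover have "v \<in> W" using v by (simp add: W_def)
  ultimately have W: "W = carrier_vec n" using v by auto
  have "T = c \<cdot>\<^sub>m 1\<^sub>m n"
  proof (rule eq_matI)
    fix i j assume "i < dim_row (c \<cdot>\<^sub>m 1\<^sub>m n)" "j < dim_col (c \<cdot>\<^sub>m 1\<^sub>m n)"
    then have ij: "i < n" "j < n" by auto
    have "unit_vec n j \<in> W" using W by simp
    then have "col T j = c \<cdot>\<^sub>v unit_vec n j"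
      using ij T by (simp add: W_def mult_unit_vec[of _ n n])
    then have "col T j $ i = (c \<cdot>\<^sub>v unit_vec n j) $ i" by simp
    then show "T $$ (i, j) = (c \<cdot>\<^sub>m 1\<^sub>m n) $$ (i, j)" using ij T by auto
  qed (use T in auto)
  then show ?thesis using that by (simp add: n_def)
qed

text \<open>\<open>rep_equiv\<close> demands a unitary intertwiner, so bijectivity of T is not
  enough. The adjoint of T intertwines in the other direction, hence T* T and T T* are scalars. They
  are nonzero because T is, which forces equal dimensions, and T divided by the square root of the
  first scalar is unitary.\<close>

lemma schur:
  assumes G: "Group.monoid G" and \<rho>: "\<rho> \<in> irreps G" and \<sigma>: "\<sigma> \<in> irreps G"
    and T: "T \<in> carrier_mat (rep_dim G \<sigma>) (rep_dim G \<rho>)"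
    and inter: "\<And>g. g \<in> carrier G \<Longrightarrow> T * \<rho> g = \<sigma> g * T"
    and T0: "T \<noteq> 0\<^sub>m (rep_dim G \<sigma>) (rep_dim G \<rho>)"
  shows "rep_equiv G \<rho> \<sigma>"
proof -
  define n where "n = rep_dim G \<rho>"
  define m where "m = rep_dim G \<sigma>"
  have u: "unitary_rep G \<rho>" "unitary_rep G \<sigma>" and n: "n > 0" and m: "m > 0"
    using \<rho> \<sigma> by (auto simp: irreps_def irreducible_rep_def Let_def n_def m_def)
  let ?S = "mat_adjoint T"
  have c: "T \<in> carrier_mat m n" "?S \<in> carrier_mat n m" using T by (auto simp: n_def m_def)
  \<comment> \<open>The adjoint of T \<rho>(g) = \<sigma>(g) T, multiplied by \<rho>(g) on the left
    and by \<sigma>(g) on the right. Unitarity of the two matrices takes the place of passing to the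
    inverse of g.\<close>
  have inter': "?S * \<sigma> g = \<rho> g * ?S" if g: "g \<in> carrier G" for g
  proof -
    note U = unitary_rep_unitary[OF G u(1) g, folded n_def] unitary_rep_unitary[OF G u(2) g, folded m_def]
    have cc: "\<rho> g \<in> carrier_mat n n" "\<sigma> g \<in> carrier_mat m m"
      "mat_adjoint (\<rho> g) \<in> carrier_mat n n" "mat_adjoint (\<sigma> g) \<in> carrier_mat m m"
      using U by (auto simp: unitary_group_carrier)
    have *: "mat_adjoint (\<rho> g) * ?S = ?S * mat_adjoint (\<sigma> g)"
      using arg_cong[OF inter[OF g], of mat_adjoint] cc c
      by (simp add: mat_adjoint_mult[of _ m n _ n] mat_adjoint_mult[of _ m m _ n])
    have "(?S * mat_adjoint (\<sigma> g)) * \<sigma> g = ?S * (mat_adjoint (\<sigma> g) * \<sigma> g)"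
      using cc c by (simp add: assoc_mult_mat[of _ n m _ m _ m])
    also have "\<dots> = ?S" using U(2) c by (simp add: unitary_group_carrier)
    finally have "\<rho> g * ?S = \<rho> g * ((?S * mat_adjoint (\<sigma> g)) * \<sigma> g)" by simp
    also have "\<dots> = (\<rho> g * mat_adjoint (\<rho> g)) * (?S * \<sigma> g)"
      unfolding *[symmetric] using cc c mult_carrier_mat[OF c(2) cc(2)]
      by (simp add: assoc_mult_mat[of _ n n _ n _ m] assoc_mult_mat[of _ n n _ m _ m])
    also have "\<dots> = ?S * \<sigma> g" using unitary_group_right[OF U(1)] cc c by simp
    finally show ?thesis by simp
  qed
  have "(?S * T) * \<rho> g = \<rho> g * (?S * T)" if g: "g \<in> carrier G" for g
  proof -
    have cc: "\<rho> g \<in> carrier_mat n n" "\<sigma> g \<in> carrier_mat m m"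
      using unitary_rep_carrier[OF G u(1) g] unitary_rep_carrier[OF G u(2) g] by (auto simp: n_def m_def)
    have "(?S * T) * \<rho> g = ?S * (\<sigma> g * T)"
      using cc c inter[OF g] by (simp add: assoc_mult_mat[of _ n m _ n _ n])
    also have "\<dots> = (?S * \<sigma> g) * T" using cc c by (simp add: assoc_mult_mat[of _ n m _ m _ n])
    also have "\<dots> = \<rho> g * (?S * T)" unfolding inter'[OF g] using cc c
      by (simp add: assoc_mult_mat[of _ n n _ m _ n])
    finally show ?thesis .
  qed
  then obtain a where a: "?S * T = a \<cdot>\<^sub>m 1\<^sub>m n"
    using irreducible_commutant_scalar[OF G \<rho>, folded n_def, OF mult_carrier_mat[OF c(2,1)]] by blast
  have "(T * ?S) * \<sigma> g = \<sigma> g * (T * ?S)" if g: "g \<in> carrier G" for g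
  proof -
    have cc: "\<rho> g \<in> carrier_mat n n" "\<sigma> g \<in> carrier_mat m m"
      using unitary_rep_carrier[OF G u(1) g] unitary_rep_carrier[OF G u(2) g] by (auto simp: n_def m_def)
    have "(T * ?S) * \<sigma> g = T * (\<rho> g * ?S)"
      using cc c inter'[OF g] by (simp add: assoc_mult_mat[of _ m n _ m _ m])
    also have "\<dots> = (T * \<rho> g) * ?S" using cc c by (simp add: assoc_mult_mat[of _ m n _ n _ m])
    also have "\<dots> = \<sigma> g * (T * ?S)" unfolding inter[OF g] using cc c
      by (simp add: assoc_mult_mat[of _ m m _ n _ m])
    finally show ?thesis .
  qed
  then obtain b where b: "T * ?S = b \<cdot>\<^sub>m 1\<^sub>m m"
    using irreducible_commutant_scalar[OF G \<sigma>, folded m_def, OF mult_carrier_mat[OF c(1,2)]] by blast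
  have a0: "a \<noteq> 0"
  proof
    assume "a = 0"
    then have "?S * T = 0\<^sub>m n n" unfolding a by (intro eq_matI) auto
    then show False using mat_adjoint_mult_self_eq_0[OF c(1)] T0 by (simp add: n_def m_def)
  qed
  have "?S \<noteq> 0\<^sub>m n m"
    using T0 mat_adjoint_adjoint[of T] by (metis mat_adjoint_zero m_def n_def)
  then have b0: "b \<noteq> 0"
  proof -
    have "b = 0 \<Longrightarrow> mat_adjoint ?S * ?S = 0\<^sub>m m m" unfolding mat_adjoint_adjoint b by (intro eq_matI) auto
    then show ?thesis using mat_adjoint_mult_self_eq_0[OF c(2)] \<open>?S \<noteq> 0\<^sub>m n m\<close> by blast
  qed
  \<comment> \<open>The nonzero scalars a and b give left inverses of T and of T*, one for each
    inequality between the dimensions.\<close>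
  have "(inverse a \<cdot>\<^sub>m ?S) * T = inverse a \<cdot>\<^sub>m (a \<cdot>\<^sub>m 1\<^sub>m n)"
    unfolding a[symmetric] by (rule mult_smult_assoc_mat[OF c(2,1)])
  also have "\<dots> = 1\<^sub>m n" using a0 by (intro eq_matI) auto
  finally have "n \<le> m" using c by (intro left_inverse_dim_le[of T m n "inverse a \<cdot>\<^sub>m ?S"]) auto
  moreover have "m \<le> n"
  proof -
    have "(inverse b \<cdot>\<^sub>m T) * ?S = inverse b \<cdot>\<^sub>m (b \<cdot>\<^sub>m 1\<^sub>m m)"
      unfolding b[symmetric] by (rule mult_smult_assoc_mat[OF c])
    also have "\<dots> = 1\<^sub>m m" using b0 by (intro eq_matI) auto
    finally show ?thesis using c by (intro left_inverse_dim_le[of ?S n m "inverse b \<cdot>\<^sub>m T"]) auto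
  qed
  ultimately have mn: "m = n" by simp
  \<comment> \<open>The scalar a is the squared norm of the first column of T, which exists as n >
    0. So a is real and positive and has a real square root.\<close>
  have "a = (?S * T) $$ (0, 0)" unfolding a using n by simp
  also have "\<dots> = (\<Sum>k<m. ?S $$ (0, k) * T $$ (k, 0))"
    by (rule mat_mult_index[OF c(2,1) n n])
  also have "\<dots> = (\<Sum>k<m. complex_of_real ((cmod (T $$ (k, 0)))\<^sup>2))"
    using c n by (intro sum.cong refl) (metis carrier_matD complex_norm_square lessThan_iff mat_adjoint_index mult.commute)
  finally have a_eq: "a = complex_of_real (\<Sum>k<m. (cmod (T $$ (k, 0)))\<^sup>2)" unfolding of_real_sum .
  define r where "r = (\<Sum>k<m. (cmod (T $$ (k, 0)))\<^sup>2)"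
  have r1: "a = complex_of_real r" unfolding r_def by (rule a_eq)
  moreover have "r \<ge> 0" unfolding r_def by (intro sum_nonneg) auto
  ultimately have r: "a = complex_of_real r" "r > 0" using a0 by (auto simp: less_le)
  define s where "s = complex_of_real (1 / sqrt r)"
  have s: "s * (cnj s * a) = 1" using r by (simp add: s_def flip: of_real_mult)
  define U where "U = s \<cdot>\<^sub>m T"
  have Uc: "U \<in> carrier_mat n n" using c by (simp add: U_def mn)
  have "mat_adjoint U * U = s \<cdot>\<^sub>m (cnj s \<cdot>\<^sub>m (?S * T))"
    unfolding U_def mat_adjoint_smult using c
    by (simp add: mult_smult_assoc_mat[of _ n m _ n] mult_smult_distrib[of _ n m _ n])
  also have "\<dots> = 1\<^sub>m n" unfolding a using s by (intro eq_matI) auto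
  finally have Uu: "U \<in> carrier (unitary_group n)" using Uc by (simp add: unitary_group_carrier)
  have "U * \<rho> g = \<sigma> g * U" if g: "g \<in> carrier G" for g
  proof -
    have cc: "\<rho> g \<in> carrier_mat n n" "\<sigma> g \<in> carrier_mat m m"
      using unitary_rep_carrier[OF G u(1) g] unitary_rep_carrier[OF G u(2) g] by (auto simp: n_def m_def)
    show ?thesis unfolding U_def
      using cc c inter[OF g] by (simp add: mult_smult_assoc_mat[of _ m n _ n] mult_smult_distrib[of _ m m _ n])
  qed
  then show ?thesis using Uu mn unfolding rep_equiv_def by (auto simp: m_def n_def)
qed

subsection \<open>Direct sums\<close>

lemma rep_dim_direct_sum: "rep_dim G (direct_sum_rep \<rho>s) = sum_list (map (rep_dim G) \<rho>s)"
  by (simp add: rep_dim_def[abs_def] direct_sum_rep_def dim_diag_block_mat comp_def)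

lemma direct_sum_rep_carrier:
  assumes "\<And>\<rho>. \<rho> \<in> set \<rho>s \<Longrightarrow> \<rho> g \<in> carrier_mat (rep_dim G \<rho>) (rep_dim G \<rho>)"
  shows "direct_sum_rep \<rho>s g \<in> carrier_mat (rep_dim G (direct_sum_rep \<rho>s)) (rep_dim G (direct_sum_rep \<rho>s))"
proof -
  have "map (dim_row \<circ> (\<lambda>\<rho>. \<rho> g)) \<rho>s = map (rep_dim G) \<rho>s" "map (dim_col \<circ> (\<lambda>\<rho>. \<rho> g)) \<rho>s = map (rep_dim G) \<rho>s"
    using assms by (auto intro!: map_cong)
  then show ?thesis
    unfolding rep_dim_direct_sum by (intro carrier_matI) (simp_all only: direct_sum_rep_def dim_diag_block_mat list.map_comp)
qed

lemma direct_sum_rep_append: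
  assumes "\<And>\<rho>. \<rho> \<in> set (\<rho>s @ \<sigma>s) \<Longrightarrow> \<rho> g \<in> carrier_mat (rep_dim G \<rho>) (rep_dim G \<rho>)"
  defines "m \<equiv> rep_dim G (direct_sum_rep \<rho>s)" and "n \<equiv> rep_dim G (direct_sum_rep \<sigma>s)"
  shows "direct_sum_rep (\<rho>s @ \<sigma>s) g =
    four_block_mat (direct_sum_rep \<rho>s g) (0\<^sub>m m n) (0\<^sub>m n m) (direct_sum_rep \<sigma>s g)"
  using direct_sum_rep_carrier[of \<rho>s g G] direct_sum_rep_carrier[of \<sigma>s g G] assms(1)
  by (simp add: direct_sum_rep_def diag_block_mat_append Let_def m_def n_def)

lemma direct_sum_rep_Cons:
  assumes "\<And>\<rho>. \<rho> \<in> set (\<sigma> # \<rho>s) \<Longrightarrow> \<rho> g \<in> carrier_mat (rep_dim G \<rho>) (rep_dim G \<rho>)"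
  defines "m \<equiv> rep_dim G \<sigma>" and "n \<equiv> rep_dim G (direct_sum_rep \<rho>s)"
  shows "direct_sum_rep (\<sigma> # \<rho>s) g =
    four_block_mat (\<sigma> g) (0\<^sub>m m n) (0\<^sub>m n m) (direct_sum_rep \<rho>s g)"
proof -
  have "rep_dim G (direct_sum_rep [\<sigma>]) = m" by (simp add: rep_dim_direct_sum m_def)
  moreover have "direct_sum_rep [\<sigma>] g = \<sigma> g"
    unfolding direct_sum_rep_def list.map diag_block_mat_singleton ..
  ultimately show ?thesis
    using direct_sum_rep_append[of "[\<sigma>]" \<rho>s g G] assms(1) by (simp add: n_def)
qed

text \<open>The offset is the total dimension of the summands before the first occurrence of
  \<sigma>, whose diagonal block starts there.\<close>

lemma direct_sum_rep_coefficient: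
  assumes "\<And>\<rho> g. \<rho> \<in> set \<rho>s \<Longrightarrow> g \<in> carrier G \<Longrightarrow> \<rho> g \<in> carrier_mat (rep_dim G \<rho>) (rep_dim G \<rho>)"
    and "\<sigma> \<in> set \<rho>s"
  shows "\<exists>k. k + rep_dim G \<sigma> \<le> rep_dim G (direct_sum_rep \<rho>s) \<and>
    (\<forall>g\<in>carrier G. \<forall>i<rep_dim G \<sigma>. \<forall>j<rep_dim G \<sigma>. direct_sum_rep \<rho>s g $$ (k + i, k + j) = \<sigma> g $$ (i, j))"
  using assms
proof (induction \<rho>s)
  case (Cons \<rho> \<rho>s)
  let ?m = "rep_dim G \<rho>" and ?n = "rep_dim G (direct_sum_rep \<rho>s)"
  have dim: "rep_dim G (direct_sum_rep (\<rho> # \<rho>s)) = ?m + ?n" by (simp add: rep_dim_direct_sum)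
  have car: "\<rho> g \<in> carrier_mat ?m ?m" "direct_sum_rep \<rho>s g \<in> carrier_mat ?n ?n" if "g \<in> carrier G" for g
    using that Cons.prems(1) direct_sum_rep_carrier[of \<rho>s g G] by auto
  have eq: "direct_sum_rep (\<rho> # \<rho>s) g =
    four_block_mat (\<rho> g) (0\<^sub>m ?m ?n) (0\<^sub>m ?n ?m) (direct_sum_rep \<rho>s g)" if "g \<in> carrier G" for g
    using that Cons.prems(1) by (intro direct_sum_rep_Cons) auto
  show ?case
  proof (cases "\<sigma> = \<rho>")
    case True
    show ?thesis
    proof (rule exI[of _ 0], safe)
      show "0 + rep_dim G \<sigma> \<le> rep_dim G (direct_sum_rep (\<rho> # \<rho>s))" using True dim by simp
      fix g i j assume "g \<in> carrier G" "i < rep_dim G \<sigma>" "j < rep_dim G \<sigma>"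
      then show "direct_sum_rep (\<rho> # \<rho>s) g $$ (0 + i, 0 + j) = \<sigma> g $$ (i, j)"
        using True car[of g] eq[of g] by auto
    qed
  next
    case False
    then obtain k where k: "k + rep_dim G \<sigma> \<le> ?n"
      "\<forall>g\<in>carrier G. \<forall>i<rep_dim G \<sigma>. \<forall>j<rep_dim G \<sigma>. direct_sum_rep \<rho>s g $$ (k + i, k + j) = \<sigma> g $$ (i, j)"
      using Cons.IH Cons.prems by auto
    show ?thesis
    proof (rule exI[of _ "?m + k"], safe)
      show "?m + k + rep_dim G \<sigma> \<le> rep_dim G (direct_sum_rep (\<rho> # \<rho>s))" using k(1) dim by simp
      fix g i j assume g: "g \<in> carrier G" and ij: "i < rep_dim G \<sigma>" "j < rep_dim G \<sigma>"
      have "direct_sum_rep (\<rho> # \<rho>s) g $$ (?m + k + i, ?m + k + j) = direct_sum_rep \<rho>s g $$ (k + i, k + j)"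
        unfolding eq[OF g] using car[OF g] k(1) ij by (subst index_mat_four_block) auto
      then show "direct_sum_rep (\<rho> # \<rho>s) g $$ (?m + k + i, ?m + k + j) = \<sigma> g $$ (i, j)"
        using k(2) g ij by simp
    qed
  qed
qed simp

section \<open>Traces, as invariants of equivalence\<close>

lemma sum_lessThan_add:
  fixes f :: "nat \<Rightarrow> 'a::comm_monoid_add"
  shows "(\<Sum>i<m + n. f i) = (\<Sum>i<m. f i) + (\<Sum>i<n. f (m + i))"
  by (induction n) (simp_all add: add.assoc)

text \<open>Its values on a representation form the character. Traces are used to show that
  multiplicities do not depend on the decomposition.\<close>

definition mat_trace :: "'a::comm_monoid_add mat \<Rightarrow> 'a" where
  "mat_trace A = (\<Sum>i<dim_row A. A $$ (i, i))"

lemma mat_trace_mult_comm: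
  fixes A :: "'a::comm_semiring_0 mat"
  assumes A: "A \<in> carrier_mat m n" and B: "B \<in> carrier_mat n m"
  shows "mat_trace (A * B) = mat_trace (B * A)"
proof -
  have "mat_trace (A * B) = (\<Sum>i<m. \<Sum>k<n. A $$ (i, k) * B $$ (k, i))"
    using A B by (auto simp: mat_trace_def mat_mult_index[OF A B] simp del: index_mult_mat(1) intro!: sum.cong)
  also have "\<dots> = (\<Sum>k<n. \<Sum>i<m. B $$ (k, i) * A $$ (i, k))"
    by (subst sum.swap) (simp add: mult.commute)
  also have "\<dots> = mat_trace (B * A)"
    using A B by (auto simp: mat_trace_def mat_mult_index[OF B A] simp del: index_mult_mat(1) intro!: sum.cong)
  finally show ?thesis .
qed

lemma mat_trace_four_block:
  assumes "A \<in> carrier_mat m m" "D \<in> carrier_mat n n"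
  shows "mat_trace (four_block_mat A B C D) = mat_trace A + mat_trace D"
proof -
  have "mat_trace (four_block_mat A B C D) = (\<Sum>i<m + n. if i < m then A $$ (i, i) else D $$ (i - m, i - m))"
    using assms by (auto simp: mat_trace_def intro!: sum.cong)
  also have "\<dots> = mat_trace A + mat_trace D"
    using assms
    by (simp add: sum_lessThan_add mat_trace_def)
  finally show ?thesis .
qed

lemma mat_trace_direct_sum_rep:
  assumes "\<And>\<rho>. \<rho> \<in> set \<rho>s \<Longrightarrow> \<rho> g \<in> carrier_mat (rep_dim G \<rho>) (rep_dim G \<rho>)"
  shows "mat_trace (direct_sum_rep \<rho>s g) = (\<Sum>\<rho>\<leftarrow>\<rho>s. mat_trace (\<rho> g))"
  using assms
proof (induction \<rho>s)
  case Nil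
  then show ?case by (simp add: direct_sum_rep_def mat_trace_def)
next
  case (Cons \<rho> \<rho>s)
  have "mat_trace (direct_sum_rep (\<rho> # \<rho>s) g) = mat_trace (\<rho> g) + mat_trace (direct_sum_rep \<rho>s g)"
    using Cons.prems direct_sum_rep_carrier[of \<rho>s g G]
    by (subst direct_sum_rep_Cons[of _ _ _ G]) (auto intro!: mat_trace_four_block)
  then show ?case using Cons by simp
qed

lemma mat_trace_rep_equiv:
  assumes "\<And>g. g \<in> carrier G \<Longrightarrow> \<rho> g \<in> carrier_mat (rep_dim G \<rho>) (rep_dim G \<rho>)"
    and "\<And>g. g \<in> carrier G \<Longrightarrow> \<sigma> g \<in> carrier_mat (rep_dim G \<sigma>) (rep_dim G \<sigma>)"
    and "rep_equiv G \<rho> \<sigma>" and g: "g \<in> carrier G"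
  shows "mat_trace (\<rho> g) = mat_trace (\<sigma> g)"
proof -
  let ?n = "rep_dim G \<rho>"
  from assms(3) obtain U where U: "U \<in> carrier (unitary_group ?n)"
    "\<And>g. g \<in> carrier G \<Longrightarrow> U * \<rho> g = \<sigma> g * U" and n: "rep_dim G \<sigma> = ?n"
    by (rule rep_equivE) blast
  have c: "U \<in> carrier_mat ?n ?n" "mat_adjoint U \<in> carrier_mat ?n ?n" "mat_adjoint U * U = 1\<^sub>m ?n"
    using U(1) by (auto simp: unitary_group_carrier)
  have r: "\<rho> g \<in> carrier_mat ?n ?n" "\<sigma> g \<in> carrier_mat ?n ?n" using assms(1,2)[OF g] n by auto
  have "\<rho> g = (mat_adjoint U * U) * \<rho> g" using c r by simp
  also have "\<dots> = mat_adjoint U * (\<sigma> g * U)" using c(1,2) r U(2)[OF g] by (simp add: assoc_mult_mat[of _ ?n ?n _ ?n _ ?n])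
  finally have "mat_trace (\<rho> g) = mat_trace (mat_adjoint U * (\<sigma> g * U))" by simp
  also have "\<dots> = mat_trace (\<sigma> g * U * mat_adjoint U)" using c r by (intro mat_trace_mult_comm[of _ ?n ?n]) auto
  also have "\<sigma> g * U * mat_adjoint U = \<sigma> g"
    using c r by (simp add: assoc_mult_mat[of _ ?n ?n _ ?n _ ?n] unitary_group_right[OF U(1)])
  finally show ?thesis .
qed

section \<open>Equivalence of block sums, and conjugation by a unitary matrix\<close>

lemma rep_equiv_four_block:
  assumes "\<And>g. g \<in> carrier G \<Longrightarrow> \<rho> g \<in> carrier_mat (rep_dim G \<rho>) (rep_dim G \<rho>)"
    and "\<And>g. g \<in> carrier G \<Longrightarrow> \<sigma> g \<in> carrier_mat (rep_dim G \<sigma>) (rep_dim G \<sigma>)"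
    and car: "\<And>\<rho> g. \<rho> \<in> set (\<rho>s @ \<sigma>s) \<Longrightarrow> g \<in> carrier G \<Longrightarrow> \<rho> g \<in> carrier_mat (rep_dim G \<rho>) (rep_dim G \<rho>)"
    and "rep_equiv G \<rho> (direct_sum_rep \<rho>s)" "rep_equiv G \<sigma> (direct_sum_rep \<sigma>s)"
  shows "rep_equiv G (\<lambda>g. four_block_mat (\<rho> g) (0\<^sub>m (rep_dim G \<rho>) (rep_dim G \<sigma>)) (0\<^sub>m (rep_dim G \<sigma>) (rep_dim G \<rho>)) (\<sigma> g))
    (direct_sum_rep (\<rho>s @ \<sigma>s))"
proof -
  let ?m = "rep_dim G \<rho>" and ?n = "rep_dim G \<sigma>"
  from assms(4) obtain U where U: "U \<in> carrier (unitary_group ?m)"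
    "\<And>g. g \<in> carrier G \<Longrightarrow> U * \<rho> g = direct_sum_rep \<rho>s g * U" and m: "rep_dim G (direct_sum_rep \<rho>s) = ?m"
    by (rule rep_equivE) blast
  from assms(5) obtain V where V: "V \<in> carrier (unitary_group ?n)"
    "\<And>g. g \<in> carrier G \<Longrightarrow> V * \<sigma> g = direct_sum_rep \<sigma>s g * V" and n: "rep_dim G (direct_sum_rep \<sigma>s) = ?n"
    by (rule rep_equivE) blast
  have c: "U \<in> carrier_mat ?m ?m" "V \<in> carrier_mat ?n ?n" using U(1) V(1) by (auto simp: unitary_group_carrier)
  let ?U = "four_block_mat U (0\<^sub>m ?m ?n) (0\<^sub>m ?n ?m) V"
  let ?\<tau> = "\<lambda>g. four_block_mat (\<rho> g) (0\<^sub>m ?m ?n) (0\<^sub>m ?n ?m) (\<sigma> g)"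
  have "?U * ?\<tau> g = direct_sum_rep (\<rho>s @ \<sigma>s) g * ?U" if g: "g \<in> carrier G" for g
  proof -
    have d: "direct_sum_rep \<rho>s g \<in> carrier_mat ?m ?m" "direct_sum_rep \<sigma>s g \<in> carrier_mat ?n ?n"
      using direct_sum_rep_carrier[of \<rho>s g G] direct_sum_rep_carrier[of \<sigma>s g G] car g m n by auto
    have "?U * ?\<tau> g = four_block_mat (U * \<rho> g) (0\<^sub>m ?m ?n) (0\<^sub>m ?n ?m) (V * \<sigma> g)"
      using c assms(1,2)[OF g] mult_carrier_mat[OF c(1) assms(1)[OF g]] mult_carrier_mat[OF c(2) assms(2)[OF g]]
      by (subst mult_four_block_mat[of _ ?m ?m _ ?n _ ?n _ _ ?m _ ?n]) auto
    also have "\<dots> = four_block_mat (direct_sum_rep \<rho>s g * U) (0\<^sub>m ?m ?n) (0\<^sub>m ?n ?m) (direct_sum_rep \<sigma>s g * V)"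
      using U(2)[OF g] V(2)[OF g] by simp
    also have "\<dots> = direct_sum_rep (\<rho>s @ \<sigma>s) g * ?U"
      using c d car g mult_carrier_mat[OF d(1) c(1)] mult_carrier_mat[OF d(2) c(2)]
      by (subst direct_sum_rep_append[of _ _ _ G], simp, unfold m n,
          subst mult_four_block_mat[of _ ?m ?m _ ?n _ ?n _ _ ?m _ ?n]) auto
    finally show ?thesis .
  qed
  moreover have "rep_dim G ?\<tau> = ?m + ?n" by (simp add: rep_dim_def)
  moreover have "rep_dim G (direct_sum_rep (\<rho>s @ \<sigma>s)) = ?m + ?n"
    using m n by (simp add: rep_dim_direct_sum)
  ultimately show ?thesis
    unfolding rep_equiv_def using unitary_group_four_block[OF U(1) V(1)] by auto
qed

lemma unitary_rep_conjugate:
  assumes G: "Group.monoid G" and \<tau>: "unitary_rep G \<tau>" and U: "U \<in> carrier (unitary_group (rep_dim G \<tau>))"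
  shows "unitary_rep G (\<lambda>g. mat_adjoint U * \<tau> g * U)" "rep_dim G (\<lambda>g. mat_adjoint U * \<tau> g * U) = rep_dim G \<tau>"
    "rep_equiv G \<tau> (\<lambda>g. mat_adjoint U * \<tau> g * U)"
proof -
  let ?n = "rep_dim G \<tau>" and ?\<sigma> = "\<lambda>g. mat_adjoint U * \<tau> g * U"
  note a = assoc_mult_mat[of _ ?n ?n _ ?n _ ?n] mult_carrier_mat[of _ ?n ?n _ ?n]
  note car = unitary_rep_carrier[OF G \<tau>]
  have c: "U \<in> carrier_mat ?n ?n" "mat_adjoint U \<in> carrier_mat ?n ?n" using U by (auto simp: unitary_group_carrier)
  have 1: "?\<sigma> g \<in> carrier (unitary_group ?n)" if "g \<in> carrier G" for g
    using U unitary_rep_unitary[OF G \<tau> that] by (intro unitary_group_mult unitary_group_adjoint)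
  have 2: "?\<sigma> (g \<otimes>\<^bsub>G\<^esub> h) = ?\<sigma> g * ?\<sigma> h" if g: "g \<in> carrier G" and h: "h \<in> carrier G" for g h
  proof -
    have "?\<sigma> g * ?\<sigma> h = mat_adjoint U * \<tau> g * ((U * mat_adjoint U) * (\<tau> h * U))"
      using c car[OF g] car[OF h] by (simp add: a)
    also have "\<dots> = mat_adjoint U * \<tau> g * (\<tau> h * U)"
      unfolding unitary_group_right[OF U] left_mult_one_mat[OF mult_carrier_mat[OF car[OF h] c(1)]] ..
    also have "\<dots> = ?\<sigma> (g \<otimes>\<^bsub>G\<^esub> h)"
      using c car[OF g] car[OF h] by (simp add: a unitary_rep_mult[OF G \<tau> g h])
    finally show ?thesis by simp
  qed
  have 3: "continuous_on (carrier G) (\<lambda>g. ?\<sigma> g $$ (i, j))" if ij: "i < ?n" "j < ?n" for i j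
  proof -
    have "?\<sigma> g $$ (i, j) = (\<Sum>l<?n. (\<Sum>k<?n. mat_adjoint U $$ (i, k) * \<tau> g $$ (k, l)) * U $$ (l, j))"
      if g: "g \<in> carrier G" for g
      using c car[OF g] ij
      by (simp add: mat_mult_index[OF mult_carrier_mat[OF c(2) car[OF g]] c(1)] mat_mult_index[OF c(2) car[OF g]]
          del: index_mult_mat(1))
    moreover have "continuous_on (carrier G)
      (\<lambda>g. \<Sum>l<?n. (\<Sum>k<?n. mat_adjoint U $$ (i, k) * \<tau> g $$ (k, l)) * U $$ (l, j))"
      by (intro continuous_intros unitary_rep_continuous[OF G \<tau>]) auto
    ultimately show ?thesis by (simp cong: continuous_on_cong)
  qed
  show "unitary_rep G ?\<sigma>" "rep_dim G ?\<sigma> = ?n" using unitary_repI[OF G 1 2 3] by blast+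
  have "mat_adjoint U * \<tau> g = ?\<sigma> g * mat_adjoint U" if "g \<in> carrier G" for g
    using c car[OF that] by (simp add: a unitary_group_right[OF U])
  then show "rep_equiv G \<tau> ?\<sigma>"
    unfolding rep_equiv_def \<open>rep_dim G ?\<sigma> = ?n\<close> using unitary_group_adjoint[OF U] by auto
qed

subsection \<open>Complete reducibility\<close>

text \<open>U x is a linear combination of the columns of U; the induction adds one column at a
  time.\<close>

lemma vec_subspace_mult_mat_vec:
  assumes W: "vec_subspace n W" and U: "U \<in> carrier_mat n k" and col: "\<And>j. j < k \<Longrightarrow> col U j \<in> W"
    and x: "x \<in> carrier_vec k"
  shows "U *\<^sub>v x \<in> W"
proof -
  have "Matrix.vec n (\<lambda>i. \<Sum>j<m. U $$ (i, j) * x $ j) \<in> W" if "m \<le> k" for m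
    using that
  proof (induction m)
    case 0
    have "Matrix.vec n (\<lambda>i. \<Sum>j<0. U $$ (i, j) * x $ j) = 0\<^sub>v n" by (intro eq_vecI) auto
    then show ?case using W by (simp add: vec_subspace_iff)
  next
    case (Suc m)
    have "Matrix.vec n (\<lambda>i. \<Sum>j<Suc m. U $$ (i, j) * x $ j)
      = Matrix.vec n (\<lambda>i. \<Sum>j<m. U $$ (i, j) * x $ j) + x $ m \<cdot>\<^sub>v col U m"
      using U Suc.prems by (intro eq_vecI) auto
    moreover have "Matrix.vec n (\<lambda>i. \<Sum>j<m. U $$ (i, j) * x $ j) \<in> W" "col U m \<in> W"
      using Suc col by auto
    ultimately show ?case using W by (simp only: vec_subspace_iff)
  qed
  from this[of k] have "Matrix.vec n (\<lambda>i. \<Sum>j<k. U $$ (i, j) * x $ j) \<in> W" by simp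
  also have "Matrix.vec n (\<lambda>i. \<Sum>j<k. U $$ (i, j) * x $ j) = U *\<^sub>v x"
    using U x by (intro eq_vecI) (auto simp: scalar_prod_def lessThan_atLeast0)
  finally show ?thesis .
qed

text \<open>In a basis adapted to a proper nonzero invariant subspace the matrices become block
  upper triangular. Being unitary, they are then block diagonal, and the diagonal blocks are the two
  representations.\<close>

lemma unitary_rep_split:
  assumes G: "Group.monoid G" and \<tau>: "unitary_rep G \<tau>" and n: "rep_dim G \<tau> > 0" and red: "\<not> irreducible_rep G \<tau>"
  obtains \<alpha> \<beta> where "unitary_rep G \<alpha>" "unitary_rep G \<beta>" "rep_dim G \<alpha> < rep_dim G \<tau>" "rep_dim G \<beta> < rep_dim G \<tau>"
    "rep_equiv G \<tau> (\<lambda>g. four_block_mat (\<alpha> g) (0\<^sub>m (rep_dim G \<alpha>) (rep_dim G \<beta>)) (0\<^sub>m (rep_dim G \<beta>) (rep_dim G \<alpha>)) (\<beta> g))"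
proof -
  interpret Group.monoid G by fact
  define n where "n = rep_dim G \<tau>"
  obtain W where W: "vec_subspace n W" and inv: "\<And>g w. g \<in> carrier G \<Longrightarrow> w \<in> W \<Longrightarrow> \<tau> g *\<^sub>v w \<in> W"
    and W0: "W \<noteq> {0\<^sub>v n}" "W \<noteq> carrier_vec n"
    using red n by (auto simp: irreducible_rep_def Let_def n_def)
  obtain U k where U: "U \<in> carrier (unitary_group n)" and "k \<le> n" and colW: "\<And>j. j < k \<Longrightarrow> col U j \<in> W"
    and orth: "\<And>w j. w \<in> W \<Longrightarrow> k \<le> j \<Longrightarrow> j < n \<Longrightarrow> w \<bullet>c col U j = 0"
    using exists_adapted_unitary[OF W] by blast
  have c: "U \<in> carrier_mat n n" "mat_adjoint U \<in> carrier_mat n n" using U by (auto simp: unitary_group_carrier)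
  have rec: "U *\<^sub>v (mat_adjoint U *\<^sub>v v) = v" if "v \<in> carrier_vec n" for v
    using c that assoc_mult_mat_vec[OF c that] by (simp add: unitary_group_right[OF U])
  have Wn: "W \<subseteq> carrier_vec n" "0\<^sub>v n \<in> W" using W by (auto simp: vec_subspace_iff)
  have colsum: "(M *\<^sub>v v) \<bullet>c col U i = (\<Sum>l<n. mat_adjoint U $$ (i, l) * (M *\<^sub>v v) $ l)" if "i < n" for M v i
    using that c by (subst cscalar_prod_sum[of _ n]) (auto simp: mult.commute intro!: sum.cong)
  \<comment> \<open>The size k of the first block is known only through the adapted basis, so the
    two conditions on W have to be transferred to it: k = n would make W the whole space, and k = 0
    would make W orthogonal to every column, hence zero. Thus both blocks are smaller than \<tau>,
    as the induction on the dimension requires.\<close>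
  have "k \<noteq> n"
  proof
    assume "k = n"
    have "v \<in> W" if v: "v \<in> carrier_vec n" for v
      using vec_subspace_mult_mat_vec[OF W c(1), of "mat_adjoint U *\<^sub>v v"] colW \<open>k = n\<close>
        mult_mat_vec_carrier[OF c(2) v] by (simp add: rec[OF v])
    then show False using W0(2) Wn by blast
  qed
  with \<open>k \<le> n\<close> have kn: "k < n" by simp
  have "k \<noteq> 0"
  proof
    assume "k = 0"
    have "w = 0\<^sub>v n" if w: "w \<in> W" for w
    proof -
      have wn: "w \<in> carrier_vec n" using w Wn by blast
      have "mat_adjoint U *\<^sub>v w = 0\<^sub>v n"
      proof (rule eq_vecI)
        fix i assume "i < dim_vec (0\<^sub>v n :: complex vec)"
        then have i: "i < n" by simp
        have "(mat_adjoint U *\<^sub>v w) $ i = w \<bullet>c col U i"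
          using i c wn by (subst cscalar_prod_sum[of _ n])
            (auto simp: scalar_prod_def lessThan_atLeast0 mult.commute intro!: sum.cong)
        then show "(mat_adjoint U *\<^sub>v w) $ i = 0\<^sub>v n $ i" using orth[OF w _ i] \<open>k = 0\<close> i by simp
      qed (use c in auto)
      then have "w = U *\<^sub>v 0\<^sub>v n" using rec[OF wn] by simp
      then show ?thesis using c by (auto intro!: eq_vecI)
    qed
    then show False using W0(1) Wn(2) by blast
  qed
  define m where "m = n - k"
  have nkm: "n = k + m" and km: "0 < k" "0 < m" using kn \<open>k \<noteq> 0\<close> by (auto simp: m_def)
  define \<sigma> where "\<sigma> = (\<lambda>g. mat_adjoint U * \<tau> g * U)"
  note conj = unitary_rep_conjugate[OF G \<tau> U[unfolded n_def], folded \<sigma>_def, folded n_def]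
  note \<sigma>U = unitary_rep_unitary[OF G conj(1), unfolded conj(2)]
  note \<sigma>c = unitary_rep_carrier[OF G conj(1), unfolded conj(2)]
  define \<alpha> where "\<alpha> = (\<lambda>g. Matrix.mat k k (\<lambda>(i, j). \<sigma> g $$ (i, j)))"
  define \<delta> where "\<delta> = (\<lambda>g. Matrix.mat k m (\<lambda>(i, j). \<sigma> g $$ (i, k + j)))"
  define \<beta> where "\<beta> = (\<lambda>g. Matrix.mat m m (\<lambda>(i, j). \<sigma> g $$ (k + i, k + j)))"
  have bc: "\<alpha> g \<in> carrier_mat k k" "\<delta> g \<in> carrier_mat k m" "\<beta> g \<in> carrier_mat m m" for g
    by (auto simp: \<alpha>_def \<beta>_def \<delta>_def)
  \<comment> \<open>This entry is the inner product of \<tau>(g) applied to column j, which stays in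
    W by invariance, with column i, which is orthogonal to W.\<close>
  have low: "\<sigma> g $$ (i, j) = 0" if g: "g \<in> carrier G" and ij: "k \<le> i" "i < n" "j < k" for g i j
  proof -
    have \<tau>c: "\<tau> g \<in> carrier_mat n n" using unitary_rep_carrier[OF G \<tau> g] by (simp add: n_def)
    have "\<sigma> g $$ (i, j) = (mat_adjoint U * (\<tau> g * U)) $$ (i, j)"
      using c \<tau>c by (simp add: \<sigma>_def assoc_mult_mat[of _ n n _ n _ n])
    also have "\<dots> = (\<Sum>l<n. mat_adjoint U $$ (i, l) * (\<tau> g * U) $$ (l, j))"
      using c \<tau>c ij kn by (intro mat_mult_index[of _ n n _ n]) auto
    also have "\<dots> = (\<Sum>l<n. mat_adjoint U $$ (i, l) * (\<tau> g *\<^sub>v col U j) $ l)"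
      using c \<tau>c ij kn by (intro sum.cong) auto
    also have "\<dots> = (\<tau> g *\<^sub>v col U j) \<bullet>c col U i" using colsum[OF ij(2)] by simp
    also have "\<dots> = 0" using orth[OF inv[OF g colW[OF ij(3)]] ij(1,2)] .
    finally show ?thesis .
  qed
  have blk: "\<sigma> g = four_block_mat (\<alpha> g) (\<delta> g) (0\<^sub>m m k) (\<beta> g)" if g: "g \<in> carrier G" for g
  proof (rule eq_matI)
    fix i j assume "i < dim_row (four_block_mat (\<alpha> g) (\<delta> g) (0\<^sub>m m k) (\<beta> g))"
      "j < dim_col (four_block_mat (\<alpha> g) (\<delta> g) (0\<^sub>m m k) (\<beta> g))"
    then have ij: "i < k + m" "j < k + m" by (auto simp: \<alpha>_def \<beta>_def)
    then show "\<sigma> g $$ (i, j) = four_block_mat (\<alpha> g) (\<delta> g) (0\<^sub>m m k) (\<beta> g) $$ (i, j)"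
      using low[OF g, of i j] by (auto simp: \<alpha>_def \<beta>_def \<delta>_def nkm)
  qed (use \<sigma>c[OF g] in \<open>auto simp: \<alpha>_def \<beta>_def nkm\<close>)
  have tri: "\<delta> g = 0\<^sub>m k m" "\<alpha> g \<in> carrier (unitary_group k)" "\<beta> g \<in> carrier (unitary_group m)"
    if g: "g \<in> carrier G" for g
    using unitary_block_triangular[OF bc(1,2,3)] \<sigma>U[OF g] blk[OF g] nkm by simp_all
  have blk': "\<sigma> g = four_block_mat (\<alpha> g) (0\<^sub>m k m) (0\<^sub>m m k) (\<beta> g)" if g: "g \<in> carrier G" for g
    using blk[OF g] tri(1)[OF g] by simp
  have mult: "four_block_mat (\<alpha> (g \<otimes>\<^bsub>G\<^esub> h)) (0\<^sub>m k m) (0\<^sub>m m k) (\<beta> (g \<otimes>\<^bsub>G\<^esub> h))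
      = four_block_mat (\<alpha> g * \<alpha> h) (0\<^sub>m k m) (0\<^sub>m m k) (\<beta> g * \<beta> h)"
    if g: "g \<in> carrier G" and h: "h \<in> carrier G" for g h
  proof -
    have "four_block_mat (\<alpha> (g \<otimes>\<^bsub>G\<^esub> h)) (0\<^sub>m k m) (0\<^sub>m m k) (\<beta> (g \<otimes>\<^bsub>G\<^esub> h)) = \<sigma> g * \<sigma> h"
      using unitary_rep_mult[OF G conj(1) g h] blk'[of "g \<otimes>\<^bsub>G\<^esub> h"] g h by simp
    also have "\<dots> = four_block_mat (\<alpha> g * \<alpha> h) (0\<^sub>m k m) (0\<^sub>m m k) (\<beta> g * \<beta> h)"
      unfolding blk'[OF g] blk'[OF h]
      using bc[of g] bc[of h] mult_carrier_mat[OF bc(1)[of g] bc(1)[of h]] mult_carrier_mat[OF bc(3)[of g] bc(3)[of h]]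
      by (subst mult_four_block_mat[of _ k k _ m _ m _ _ k _ m]) auto
    finally show ?thesis .
  qed
  have \<alpha>m: "\<alpha> (g \<otimes>\<^bsub>G\<^esub> h) = \<alpha> g * \<alpha> h" if g: "g \<in> carrier G" and h: "h \<in> carrier G" for g h
  proof (rule eq_matI)
    fix i j assume "i < dim_row (\<alpha> g * \<alpha> h)" "j < dim_col (\<alpha> g * \<alpha> h)"
    then have "i < k" "j < k" using bc(1)[of g] bc(1)[of h] by auto
    then show "\<alpha> (g \<otimes>\<^bsub>G\<^esub> h) $$ (i, j) = (\<alpha> g * \<alpha> h) $$ (i, j)"
      using arg_cong[OF mult[OF g h], of "\<lambda>M. M $$ (i, j)"] bc(1)[of "g \<otimes>\<^bsub>G\<^esub> h"] bc(1)[of g] bc(1)[of h]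
      by (simp del: index_mult_mat(1))
  qed (use bc(1)[of g] bc(1)[of h] bc(1)[of "g \<otimes>\<^bsub>G\<^esub> h"] in auto)
  have \<beta>m: "\<beta> (g \<otimes>\<^bsub>G\<^esub> h) = \<beta> g * \<beta> h" if g: "g \<in> carrier G" and h: "h \<in> carrier G" for g h
  proof (rule eq_matI)
    fix i j assume "i < dim_row (\<beta> g * \<beta> h)" "j < dim_col (\<beta> g * \<beta> h)"
    then have "i < m" "j < m" using bc(3)[of g] bc(3)[of h] by auto
    then show "\<beta> (g \<otimes>\<^bsub>G\<^esub> h) $$ (i, j) = (\<beta> g * \<beta> h) $$ (i, j)"
      using arg_cong[OF mult[OF g h], of "\<lambda>M. M $$ (k + i, k + j)"] bc[of "g \<otimes>\<^bsub>G\<^esub> h"] bc[of g] bc[of h]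
        mult_carrier_mat[OF bc(1)[of g] bc(1)[of h]]
      by (simp del: index_mult_mat(1))
  qed (use bc(3)[of g] bc(3)[of h] bc(3)[of "g \<otimes>\<^bsub>G\<^esub> h"] in auto)
  have cont: "continuous_on (carrier G) (\<lambda>g. \<sigma> g $$ (i, j))" if "i < n" "j < n" for i j
    using unitary_rep_continuous[OF G conj(1)] that conj(2) by simp
  have \<alpha>: "unitary_rep G \<alpha>" "rep_dim G \<alpha> = k"
  proof -
    have "continuous_on (carrier G) (\<lambda>g. \<alpha> g $$ (i, j))" if "i < k" "j < k" for i j
      using cont[of i j] that nkm by (simp add: \<alpha>_def)
    then show "unitary_rep G \<alpha>" "rep_dim G \<alpha> = k"
      using unitary_repI[OF G, of \<alpha> k] tri(2) \<alpha>m by blast+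
  qed
  have \<beta>: "unitary_rep G \<beta>" "rep_dim G \<beta> = m"
  proof -
    have "continuous_on (carrier G) (\<lambda>g. \<beta> g $$ (i, j))" if "i < m" "j < m" for i j
      using cont[of "k + i" "k + j"] that nkm by (simp add: \<beta>_def)
    then show "unitary_rep G \<beta>" "rep_dim G \<beta> = m"
      using unitary_repI[OF G, of \<beta> m] tri(3) \<beta>m by blast+
  qed
  let ?\<nu> = "\<lambda>g. four_block_mat (\<alpha> g) (0\<^sub>m k m) (0\<^sub>m m k) (\<beta> g)"
  have "rep_dim G ?\<nu> = rep_dim G \<sigma>" using blk'[of "\<one>\<^bsub>G\<^esub>"] by (simp add: rep_dim_def)
  moreover from conj(3) obtain V where "V \<in> carrier (unitary_group (rep_dim G \<tau>))"
    "\<And>g. g \<in> carrier G \<Longrightarrow> V * \<tau> g = \<sigma> g * V" "rep_dim G \<sigma> = rep_dim G \<tau>"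
    by (rule rep_equivE) blast
  ultimately have "rep_equiv G \<tau> ?\<nu>"
    unfolding rep_equiv_def using blk' by (metis (no_types, lifting))
  then show ?thesis using that[OF \<alpha>(1) \<beta>(1)] km nkm by (simp add: \<alpha>(2) \<beta>(2) n_def)
qed

text \<open>The existence half of the well-definedness of \<open>multiplicity_rep\<close>, by
  splitting repeatedly. Dimension 0 is allowed by \<open>unitary_rep\<close> but not by
  \<open>irreducible_rep\<close>; it corresponds to the empty sum.\<close>

lemma complete_reducibility:
  assumes G: "Group.monoid G" and "unitary_rep G \<tau>"
  shows "\<exists>\<rho>s. set \<rho>s \<subseteq> irreps G \<and> rep_equiv G \<tau> (direct_sum_rep \<rho>s)"
  using assms(2)
proof (induction "rep_dim G \<tau>" arbitrary: \<tau> rule: less_induct)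
  case less
  note car = unitary_rep_carrier[OF G less.prems]
  consider "rep_dim G \<tau> = 0" | "irreducible_rep G \<tau>" | "rep_dim G \<tau> > 0" "\<not> irreducible_rep G \<tau>" by blast
  then show ?case
  proof cases
    case 1
    have "1\<^sub>m 0 * \<tau> g = direct_sum_rep [] g * 1\<^sub>m 0" if "g \<in> carrier G" for g
      using car[OF that] 1 by (intro eq_matI) (auto simp: direct_sum_rep_def)
    then have "rep_equiv G \<tau> (direct_sum_rep [])"
      unfolding rep_equiv_def using 1
      by (auto simp: rep_dim_direct_sum unitary_group_carrier intro!: bexI[of _ "1\<^sub>m 0"])
    then show ?thesis by (intro exI[of _ "[]"]) simp
  next
    case 2
    then have "rep_equiv G \<tau> (direct_sum_rep [\<tau>])"
      using rep_equiv_refl[OF G less.prems]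
      unfolding direct_sum_rep_def list.map diag_block_mat_singleton by simp
    then show ?thesis using less.prems 2 by (intro exI[of _ "[\<tau>]"]) (simp add: irreps_def)
  next
    case 3
    obtain \<alpha> \<beta> where ab: "unitary_rep G \<alpha>" "unitary_rep G \<beta>" "rep_dim G \<alpha> < rep_dim G \<tau>" "rep_dim G \<beta> < rep_dim G \<tau>"
      and eq: "rep_equiv G \<tau> (\<lambda>g. four_block_mat (\<alpha> g) (0\<^sub>m (rep_dim G \<alpha>) (rep_dim G \<beta>)) (0\<^sub>m (rep_dim G \<beta>) (rep_dim G \<alpha>)) (\<beta> g))"
      (is "rep_equiv G \<tau> ?\<nu>")
      by (rule unitary_rep_split[OF G less.prems 3])
    obtain \<rho>s \<sigma>s where ds: "set \<rho>s \<subseteq> irreps G" "rep_equiv G \<alpha> (direct_sum_rep \<rho>s)"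
      "set \<sigma>s \<subseteq> irreps G" "rep_equiv G \<beta> (direct_sum_rep \<sigma>s)"
      using less.hyps[OF ab(3,1)] less.hyps[OF ab(4,2)] by blast
    have c: "\<rho> g \<in> carrier_mat (rep_dim G \<rho>) (rep_dim G \<rho>)" if "\<rho> \<in> set (\<rho>s @ \<sigma>s)" "g \<in> carrier G" for \<rho> g
      using that ds unitary_rep_carrier[OF G, of \<rho> g] by (auto simp: irreps_def)
    note ca = unitary_rep_carrier[OF G ab(1)] and cb = unitary_rep_carrier[OF G ab(2)]
    have "rep_equiv G ?\<nu> (direct_sum_rep (\<rho>s @ \<sigma>s))"
      by (rule rep_equiv_four_block[OF ca cb c ds(2,4)])
    moreover have "?\<nu> g \<in> carrier_mat (rep_dim G ?\<nu>) (rep_dim G ?\<nu>)" if "g \<in> carrier G" for g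
      using ca[OF that] cb[OF that] by (auto simp: rep_dim_def)
    ultimately have "rep_equiv G \<tau> (direct_sum_rep (\<rho>s @ \<sigma>s))"
      using rep_equiv_trans[OF car _ direct_sum_rep_carrier eq, of "\<rho>s @ \<sigma>s"] c by blast
    then show ?thesis using ds by (intro exI[of _ "\<rho>s @ \<sigma>s"]) simp
  qed
qed

subsection \<open>Linear independence of matrix coefficients\<close>

lemma matrix_coefficient_mult:
  assumes "Group.monoid G" "unitary_rep G \<rho>" "g \<in> carrier G" "h \<in> carrier G" "i < rep_dim G \<rho>" "j < rep_dim G \<rho>"
  shows "\<rho> (g \<otimes>\<^bsub>G\<^esub> h) $$ (i, j) = (\<Sum>k<rep_dim G \<rho>. \<rho> g $$ (i, k) * \<rho> h $$ (k, j))"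
  using assms unitary_rep_carrier[OF assms(1,2)]
  by (simp only: unitary_rep_mult[OF assms(1-4)] mat_mult_index[of _ "rep_dim G \<rho>" "rep_dim G \<rho>" _ "rep_dim G \<rho>"])

text \<open>
  Induction on the set of rows. The combinations of the entries of a new row that lie in the span of
  the old rows form a subrepresentation, so these are none or all of them. In the latter case the
  coefficients are intertwiners, hence scalars by Schur's lemma, and evaluation at the identity refutes this.
\<close>
lemma matrix_rows_independent:
  assumes G: "Group.monoid G" and F: "F \<subseteq> irreps G"
    and ineq: "\<And>\<rho> \<sigma>. \<rho> \<in> F \<Longrightarrow> \<sigma> \<in> F \<Longrightarrow> rep_equiv G \<rho> \<sigma> \<Longrightarrow> \<rho> = \<sigma>"
    and "finite S" "\<And>\<rho> i. (\<rho>, i) \<in> S \<Longrightarrow> \<rho> \<in> F \<and> i < rep_dim G \<rho>"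
    and "\<And>g. g \<in> carrier G \<Longrightarrow> (\<Sum>s\<in>S. \<Sum>j<rep_dim G (fst s). c s j * fst s g $$ (snd s, j)) = 0"
    and "s \<in> S" "j < rep_dim G (fst s)"
  shows "c s j = 0"
  using assms(4-8)
proof (induction S arbitrary: c s j rule: finite_induct)
  case (insert t S)
  interpret Group.monoid G by fact
  let ?d = "\<lambda>s. rep_dim G (fst s)" and ?e = "\<lambda>s g j. fst s g $$ (snd s, j)"
  have u: "unitary_rep G (fst s)" and irr: "fst s \<in> irreps G" and sF: "fst s \<in> F" and sn: "snd s < ?d s"
    if "s \<in> insert t S" for s
    using that insert.prems(1)[of "fst s" "snd s"] F by (auto simp: irreps_def)
  have indep: "b s j = 0" if "\<And>g. g \<in> carrier G \<Longrightarrow> (\<Sum>s\<in>S. \<Sum>j<?d s. b s j * ?e s g j) = 0" "s \<in> S" "j < ?d s" for b s j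
    using insert.IH[of b s j] insert.prems(1) that by blast
  have e_mult: "?e s (g \<otimes>\<^bsub>G\<^esub> h) j = (\<Sum>k<?d s. ?e s g k * fst s h $$ (k, j))"
    if "s \<in> insert t S" "g \<in> carrier G" "h \<in> carrier G" "j < ?d s" for s g h j
    using matrix_coefficient_mult[OF G u[OF that(1)] that(2,3) sn[OF that(1)] that(4)] .
  define \<rho> where "\<rho> = fst t"
  define d where "d = rep_dim G \<rho>"
  have \<rho>: "unitary_rep G \<rho>" "\<rho> \<in> irreps G" "\<rho> \<in> F" and t: "snd t < d"
    using u[of t] irr[of t] sF[of t] sn[of t] by (auto simp: \<rho>_def d_def)
  note \<rho>c = unitary_rep_carrier[OF G \<rho>(1), folded d_def]
  \<comment> \<open>Right translation by h preserves the span of each row and acts on the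
    coefficient vector \<open>b s\<close> through the matrix \<open>fst s h\<close>. Hence the span
    of the old rows is stable under translation, with explicit coefficients.\<close>
  have tr: "(\<Sum>s\<in>S. \<Sum>j<?d s. b s j * ?e s (g \<otimes>\<^bsub>G\<^esub> h) j)
      = (\<Sum>s\<in>S. \<Sum>k<?d s. (\<Sum>j<?d s. fst s h $$ (k, j) * b s j) * ?e s g k)"
    if g: "g \<in> carrier G" and h: "h \<in> carrier G" for b g h
  proof (rule sum.cong[OF refl])
    fix s assume s: "s \<in> S"
    have "(\<Sum>j<?d s. b s j * ?e s (g \<otimes>\<^bsub>G\<^esub> h) j) = (\<Sum>j<?d s. \<Sum>k<?d s. fst s h $$ (k, j) * b s j * ?e s g k)"
      using s g h by (intro sum.cong refl) (simp add: e_mult sum_distrib_left mult_ac)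
    also have "\<dots> = (\<Sum>k<?d s. (\<Sum>j<?d s. fst s h $$ (k, j) * b s j) * ?e s g k)"
      by (subst sum.swap) (simp add: sum_distrib_right)
    finally show "(\<Sum>j<?d s. b s j * ?e s (g \<otimes>\<^bsub>G\<^esub> h) j) = (\<Sum>k<?d s. (\<Sum>j<?d s. fst s h $$ (k, j) * b s j) * ?e s g k)" .
  qed
  define W where "W = {x \<in> carrier_vec d. \<exists>b. \<forall>g\<in>carrier G.
    (\<Sum>j<d. x $ j * \<rho> g $$ (snd t, j)) = (\<Sum>s\<in>S. \<Sum>j<?d s. b s j * ?e s g j)}"
  have "vec_subspace d W"
    unfolding vec_subspace_iff
  proof (intro conjI ballI allI)
    show "W \<subseteq> carrier_vec d" by (auto simp: W_def)
    show "0\<^sub>v d \<in> W" unfolding W_def by (auto intro!: exI[of _ "\<lambda>_ _. 0"])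
    fix x assume "x \<in> W"
    then obtain b where x: "x \<in> carrier_vec d" and b: "\<And>g. g \<in> carrier G \<Longrightarrow>
        (\<Sum>j<d. x $ j * \<rho> g $$ (snd t, j)) = (\<Sum>s\<in>S. \<Sum>j<?d s. b s j * ?e s g j)"
      by (auto simp: W_def)
    show "a \<cdot>\<^sub>v x \<in> W" for a
    proof -
      have "(\<Sum>j<d. (a \<cdot>\<^sub>v x) $ j * \<rho> g $$ (snd t, j)) = (\<Sum>s\<in>S. \<Sum>j<?d s. (a * b s j) * ?e s g j)"
        if "g \<in> carrier G" for g
      proof -
        have "(\<Sum>j<d. (a \<cdot>\<^sub>v x) $ j * \<rho> g $$ (snd t, j)) = a * (\<Sum>j<d. x $ j * \<rho> g $$ (snd t, j))"
          using x by (simp add: sum_distrib_left mult.assoc)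
        then show ?thesis unfolding b[OF that] by (simp add: sum_distrib_left mult.assoc)
      qed
      then show ?thesis using x unfolding W_def by (auto intro!: exI[of _ "\<lambda>s j. a * b s j"])
    qed
    fix y assume "y \<in> W"
    then obtain b' where y: "y \<in> carrier_vec d" and b': "\<And>g. g \<in> carrier G \<Longrightarrow>
        (\<Sum>j<d. y $ j * \<rho> g $$ (snd t, j)) = (\<Sum>s\<in>S. \<Sum>j<?d s. b' s j * ?e s g j)"
      by (auto simp: W_def)
    have "(\<Sum>j<d. (x + y) $ j * \<rho> g $$ (snd t, j)) = (\<Sum>s\<in>S. \<Sum>j<?d s. (b s j + b' s j) * ?e s g j)"
      if "g \<in> carrier G" for g
      using x y b[OF that] b'[OF that] by (simp add: distrib_right sum.distrib)
    then show "x + y \<in> W" using x y unfolding W_def by (auto intro!: exI[of _ "\<lambda>s j. b s j + b' s j"])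
  qed
  moreover have "\<rho> h *\<^sub>v x \<in> W" if h: "h \<in> carrier G" and "x \<in> W" for h x
  proof -
    obtain b where x: "x \<in> carrier_vec d" and b: "\<And>g. g \<in> carrier G \<Longrightarrow>
        (\<Sum>j<d. x $ j * \<rho> g $$ (snd t, j)) = (\<Sum>s\<in>S. \<Sum>j<?d s. b s j * ?e s g j)"
      using \<open>x \<in> W\<close> by (auto simp: W_def)
    have "(\<Sum>j<d. (\<rho> h *\<^sub>v x) $ j * \<rho> g $$ (snd t, j))
        = (\<Sum>s\<in>S. \<Sum>k<?d s. (\<Sum>j<?d s. fst s h $$ (k, j) * b s j) * ?e s g k)" if g: "g \<in> carrier G" for g
    proof -
      have "(\<Sum>j<d. (\<rho> h *\<^sub>v x) $ j * \<rho> g $$ (snd t, j)) = (\<Sum>j<d. \<Sum>k<d. x $ k * (\<rho> g $$ (snd t, j) * \<rho> h $$ (j, k)))"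
        using \<rho>c[OF h] x by (intro sum.cong refl)
          (simp add: scalar_prod_def sum_distrib_left sum_distrib_right mult_ac lessThan_atLeast0)
      also have "\<dots> = (\<Sum>k<d. x $ k * \<rho> (g \<otimes>\<^bsub>G\<^esub> h) $$ (snd t, k))"
        using e_mult[of t g h] g h by (subst sum.swap) (simp add: sum_distrib_left \<rho>_def d_def)
      also have "\<dots> = (\<Sum>s\<in>S. \<Sum>j<?d s. b s j * ?e s (g \<otimes>\<^bsub>G\<^esub> h) j)" using b g h by simp
      finally show ?thesis unfolding tr[OF g h] .
    qed
    then show ?thesis using \<rho>c[OF h] x unfolding W_def
      by (auto intro!: exI[of _ "\<lambda>s k. \<Sum>j<?d s. fst s h $$ (k, j) * b s j"])
  qed
  ultimately have "W = {0\<^sub>v d} \<or> W = carrier_vec d"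
    using \<rho>(2) by (auto simp: irreps_def irreducible_rep_def Let_def d_def)
  moreover have "W \<noteq> carrier_vec d"
  proof
    assume W: "W = carrier_vec d"
    have "\<exists>b. \<forall>g\<in>carrier G. \<rho> g $$ (snd t, k) = (\<Sum>s\<in>S. \<Sum>j<?d s. b s j * ?e s g j)" if k: "k < d" for k
    proof -
      have "unit_vec d k \<in> W" using W by simp
      then obtain b where b: "\<forall>g\<in>carrier G. (\<Sum>j<d. unit_vec d k $ j * \<rho> g $$ (snd t, j)) = (\<Sum>s\<in>S. \<Sum>j<?d s. b s j * ?e s g j)"
        unfolding W_def by blast
      have "(\<Sum>j<d. unit_vec d k $ j * \<rho> g $$ (snd t, j)) = (\<Sum>j<d. if j = k then \<rho> g $$ (snd t, j) else 0)" for g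
        using k by (intro sum.cong) auto
      then have "(\<Sum>j<d. unit_vec d k $ j * \<rho> g $$ (snd t, j)) = \<rho> g $$ (snd t, k)" for g
        using k by simp
      then show ?thesis using b by auto
    qed
    then have "\<forall>k\<in>{..<d}. \<exists>b. \<forall>g\<in>carrier G. \<rho> g $$ (snd t, k) = (\<Sum>s\<in>S. \<Sum>j<?d s. b s j * ?e s g j)"
      by simp
    from bchoice[OF this] obtain B where B: "\<And>k g. k < d \<Longrightarrow> g \<in> carrier G \<Longrightarrow>
        \<rho> g $$ (snd t, k) = (\<Sum>s\<in>S. \<Sum>j<?d s. B k s j * ?e s g j)" by auto
    \<comment> \<open>Column k of \<open>C s\<close> holds the coefficients that row s contributes
      to entry k of the new row. This arrangement makes \<open>C s\<close> a candidate intertwiner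
      from \<rho> to \<open>fst s\<close>.\<close>
    define C where "C = (\<lambda>s. Matrix.mat (?d s) d (\<lambda>(l, k). B k s l))"
    have Cc: "C s \<in> carrier_mat (?d s) d" for s by (simp add: C_def)
    have inter: "C s * \<rho> h = fst s h * C s" if s: "s \<in> S" and h: "h \<in> carrier G" for s h
    proof (rule eq_matI)
      have sc: "fst s' h \<in> carrier_mat (?d s') (?d s')" if "s' \<in> S" for s'
        using unitary_rep_carrier[OF G u h] that by blast
      fix l k assume "l < dim_row (fst s h * C s)" "k < dim_col (fst s h * C s)"
      then have lk: "l < ?d s" "k < d" using sc[OF s] by (auto simp: C_def)
      \<comment> \<open>The entry k of the new row at the product of g and h is expanded in two
        ways: first multiplying out and expanding at g, or first expanding at the product and then
        using \<open>tr\<close>. Both are combinations of the old rows as functions of g, so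
        independence of these rows identifies the coefficients.\<close>
      have "(\<Sum>m<d. B m s l * \<rho> h $$ (m, k)) - (\<Sum>j<?d s. fst s h $$ (l, j) * B k s j) = 0"
      proof (rule indep[OF _ s lk(1)])
        fix g assume g: "g \<in> carrier G"
        have "\<rho> (g \<otimes>\<^bsub>G\<^esub> h) $$ (snd t, k) = (\<Sum>m<d. \<rho> g $$ (snd t, m) * \<rho> h $$ (m, k))"
          using e_mult[of t g h k] g h lk by (simp add: \<rho>_def d_def)
        also have "\<dots> = (\<Sum>m<d. \<Sum>s\<in>S. \<Sum>l<?d s. B m s l * \<rho> h $$ (m, k) * ?e s g l)"
          using B g by (intro sum.cong refl) (simp add: sum_distrib_right sum_distrib_left mult_ac)
        also have "\<dots> = (\<Sum>s\<in>S. \<Sum>l<?d s. \<Sum>m<d. B m s l * \<rho> h $$ (m, k) * ?e s g l)"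
          by (subst sum.swap) (intro sum.cong refl sum.swap)
        finally have 1: "\<rho> (g \<otimes>\<^bsub>G\<^esub> h) $$ (snd t, k) = (\<Sum>s\<in>S. \<Sum>l<?d s. (\<Sum>m<d. B m s l * \<rho> h $$ (m, k)) * ?e s g l)"
          by (simp add: sum_distrib_right)
        have "\<rho> (g \<otimes>\<^bsub>G\<^esub> h) $$ (snd t, k) = (\<Sum>s\<in>S. \<Sum>l<?d s. (\<Sum>j<?d s. fst s h $$ (l, j) * B k s j) * ?e s g l)"
          using B[OF lk(2), of "g \<otimes>\<^bsub>G\<^esub> h"] g h tr[OF g h, of "B k"] by simp
        with 1 show "(\<Sum>s\<in>S. \<Sum>l<?d s. ((\<Sum>m<d. B m s l * \<rho> h $$ (m, k)) - (\<Sum>j<?d s. fst s h $$ (l, j) * B k s j)) * ?e s g l) = 0"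
          by (simp add: left_diff_distrib sum_subtractf)
      qed
      moreover have "(C s * \<rho> h) $$ (l, k) = (\<Sum>m<d. B m s l * \<rho> h $$ (m, k))"
        using mat_mult_index[OF Cc \<rho>c[OF h] lk] lk by (simp add: C_def del: index_mult_mat(1))
      moreover have "(fst s h * C s) $$ (l, k) = (\<Sum>j<?d s. fst s h $$ (l, j) * B k s j)"
        using mat_mult_index[OF sc[OF s] Cc lk] lk by (simp add: C_def del: index_mult_mat(1))
      ultimately show "(C s * \<rho> h) $$ (l, k) = (fst s h * C s) $$ (l, k)" by simp
    qed (use \<rho>c[OF h] unitary_rep_carrier[OF G u[OF insertI2[OF s]] h] in \<open>auto simp: C_def\<close>)
    have one: "\<one>\<^bsub>G\<^esub> \<in> carrier G" by simp
    \<comment> \<open>If s belongs to \<rho> itself, it is a different row than t, so the entry is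
      an off-diagonal entry of a scalar matrix. Otherwise \<open>fst s\<close> is inequivalent to
      \<rho> and Schur's lemma makes \<open>C s\<close> vanish.\<close>
    have zero: "B (snd t) s (snd s) = 0" if s: "s \<in> S" for s
    proof (cases "fst s = \<rho>")
      case True
      obtain m where m: "C s = m \<cdot>\<^sub>m 1\<^sub>m d"
        using irreducible_commutant_scalar[OF G \<rho>(2), of "C s"] Cc[of s] inter[OF s] True unfolding d_def by metis
      have "snd s \<noteq> snd t" using True s insert.hyps(2) by (metis \<rho>_def prod_eqI)
      moreover have "snd s < d" using sn[of s] s True by (simp add: d_def)
      ultimately have "C s $$ (snd s, snd t) = 0" unfolding m using t by simp
      then show ?thesis using t \<open>snd s < d\<close> True by (simp add: C_def d_def)
    next
      case False
      have "C s = 0\<^sub>m (?d s) d"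
      proof (rule ccontr)
        assume "C s \<noteq> 0\<^sub>m (?d s) d"
        then have "rep_equiv G \<rho> (fst s)"
          using schur[OF G \<rho>(2) irr, of s "C s"] Cc[of s] inter[OF s] s by (auto simp: d_def)
        then show False using ineq[OF \<rho>(3) sF[of s]] s False by auto
      qed
      then have "C s $$ (snd s, snd t) = 0" using t sn[of s] s by simp
      then show ?thesis using t sn[of s] s by (simp add: C_def)
    qed
    \<comment> \<open>At the identity each row is a unit vector, so only the coefficients shown to
      vanish in \<open>zero\<close> survive, whereas the diagonal entry of \<rho> expanded here has
      the value 1.\<close>
    have "?e s \<one>\<^bsub>G\<^esub> j = (if j = snd s then 1 else 0)" if "s \<in> insert t S" "j < ?d s" for s j
      using unitary_rep_one[OF G u[OF that(1)]] sn[OF that(1)] that(2) by auto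
    then have "(\<Sum>j<?d s. B (snd t) s j * ?e s \<one>\<^bsub>G\<^esub> j) = (\<Sum>j<?d s. if j = snd s then B (snd t) s j else 0)"
      if "s \<in> S" for s using that by (intro sum.cong) auto
    then have e1: "(\<Sum>j<?d s. B (snd t) s j * ?e s \<one>\<^bsub>G\<^esub> j) = B (snd t) s (snd s)" if "s \<in> S" for s
      using that sn[of s] by simp
    have "\<rho> \<one>\<^bsub>G\<^esub> $$ (snd t, snd t) = (\<Sum>s\<in>S. \<Sum>j<?d s. B (snd t) s j * ?e s \<one>\<^bsub>G\<^esub> j)"
      using B[OF t one] .
    also have "\<dots> = 0" using e1 zero by simp
    finally show False using unitary_rep_one[OF G \<rho>(1)] t by (simp add: d_def)
  qed
  ultimately have W0: "W = {0\<^sub>v d}" by blast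
  have rel: "(\<Sum>j<d. c t j * \<rho> g $$ (snd t, j)) + (\<Sum>s\<in>S. \<Sum>j<?d s. c s j * ?e s g j) = 0" if "g \<in> carrier G" for g
    using insert.prems(2)[OF that] insert.hyps by (simp add: \<rho>_def d_def)
  \<comment> \<open>The given relation itself exhibits the combination of the new row as a
    combination of old rows, with coefficients \<open>- c s j\<close>.\<close>
  have "Matrix.vec d (c t) \<in> W"
    unfolding W_def using rel
    by (auto simp: sum_negf eq_neg_iff_add_eq_0 intro!: exI[of _ "\<lambda>s j. - c s j"])
  then have ct: "c t j = 0" if "j < d" for j
    using W0 that by (metis index_vec index_zero_vec(1) singletonD)
  then have "(\<Sum>s\<in>S. \<Sum>j<?d s. c s j * ?e s g j) = 0" if "g \<in> carrier G" for g
    using rel[OF that] by simp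
  then show ?case using indep[of c s j] ct insert.prems(3,4) by (auto simp: \<rho>_def d_def)
qed simp

subsection \<open>Tensor products\<close>

lemma sum_lessThan_times:
  fixes f :: "nat \<Rightarrow> nat \<Rightarrow> 'a::comm_monoid_add"
  shows "(\<Sum>k<m * n. f (k div n) (k mod n)) = (\<Sum>x<m. \<Sum>y<n. f x y)"
proof (induction m)
  case (Suc m)
  have "(\<Sum>k<Suc m * n. f (k div n) (k mod n)) = (\<Sum>k<m * n + n. f (k div n) (k mod n))"
    by (simp add: add.commute)
  also have "\<dots> = (\<Sum>x<m. \<Sum>y<n. f x y) + (\<Sum>y<n. f m y)"
    unfolding sum_lessThan_add Suc.IH by (auto intro!: arg_cong2[where f = "(+)"] sum.cong)
  finally show ?case by simp
qed simp

lemma kronecker_mat_carrier: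
  "A \<in> carrier_mat m n \<Longrightarrow> B \<in> carrier_mat p q \<Longrightarrow> kronecker_mat A B \<in> carrier_mat (m * p) (n * q)"
  by (auto simp: kronecker_mat_def)

lemma kronecker_mat_index:
  assumes "A \<in> carrier_mat m n" "B \<in> carrier_mat p q" "i < m * p" "j < n * q"
  shows "kronecker_mat A B $$ (i, j) = A $$ (i div p, j div q) * B $$ (i mod p, j mod q)"
  using assms by (auto simp: kronecker_mat_def)

lemma div_mod_less_of_less_mult:
  fixes i :: nat
  assumes "i < m * n"
  shows "i div n < m" "i mod n < n"
proof -
  have "n > 0" using assms by (cases n) auto
  then show "i div n < m" "i mod n < n" using assms by (auto simp: less_mult_imp_div_less)
qed

text \<open>The mixed-product rule: quotient and remainder turn the summation index into a pair, and
  the sum over pairs factors.\<close>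

lemma kronecker_mat_mult:
  assumes A: "A \<in> carrier_mat m n" and B: "B \<in> carrier_mat p q" and C: "C \<in> carrier_mat n r" and D: "D \<in> carrier_mat q s"
  shows "kronecker_mat A B * kronecker_mat C D = kronecker_mat (A * C) (B * D)"
proof -
  note AB = kronecker_mat_carrier[OF A B] and CD = kronecker_mat_carrier[OF C D]
  note AC = mult_carrier_mat[OF A C] and BD = mult_carrier_mat[OF B D]
  note R = kronecker_mat_carrier[OF AC BD]
  show ?thesis
  proof (rule eq_matI)
    fix i j assume "i < dim_row (kronecker_mat (A * C) (B * D))" "j < dim_col (kronecker_mat (A * C) (B * D))"
    then have ij: "i < m * p" "j < r * s" using R by auto
    note dm = div_mod_less_of_less_mult[OF ij(1)] div_mod_less_of_less_mult[OF ij(2)]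
    have "(kronecker_mat A B * kronecker_mat C D) $$ (i, j)
      = (\<Sum>k<n * q. kronecker_mat A B $$ (i, k) * kronecker_mat C D $$ (k, j))"
      by (rule mat_mult_index[OF AB CD ij])
    also have "\<dots> = (\<Sum>k<n * q. (A $$ (i div p, k div q) * B $$ (i mod p, k mod q)) *
        (C $$ (k div q, j div s) * D $$ (k mod q, j mod s)))"
      using ij by (intro sum.cong refl) (simp add: kronecker_mat_index[OF A B] kronecker_mat_index[OF C D])
    also have "\<dots> = (\<Sum>x<n. \<Sum>y<q. (A $$ (i div p, x) * B $$ (i mod p, y)) * (C $$ (x, j div s) * D $$ (y, j mod s)))"
      by (rule sum_lessThan_times)
    also have "\<dots> = (\<Sum>x<n. A $$ (i div p, x) * C $$ (x, j div s)) * (\<Sum>y<q. B $$ (i mod p, y) * D $$ (y, j mod s))"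
      by (simp add: sum_product mult_ac)
    also have "\<dots> = kronecker_mat (A * C) (B * D) $$ (i, j)"
      unfolding kronecker_mat_index[OF AC BD ij] mat_mult_index[OF A C dm(1,3)] mat_mult_index[OF B D dm(2,4)] ..
    finally show "(kronecker_mat A B * kronecker_mat C D) $$ (i, j) = kronecker_mat (A * C) (B * D) $$ (i, j)" .
  qed (use AB CD R in auto)
qed

lemma kronecker_mat_one: "kronecker_mat (1\<^sub>m m) (1\<^sub>m n) = 1\<^sub>m (m * n)"
proof (rule eq_matI)
  fix i j assume "i < dim_row (1\<^sub>m (m * n) :: complex mat)" "j < dim_col (1\<^sub>m (m * n) :: complex mat)"
  then have ij: "i < m * n" "j < m * n" by auto
  have "i = j \<longleftrightarrow> i div n = j div n \<and> i mod n = j mod n" by (metis div_mult_mod_eq)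
  then show "kronecker_mat (1\<^sub>m m) (1\<^sub>m n) $$ (i, j) = 1\<^sub>m (m * n) $$ (i, j)"
    using ij div_mod_less_of_less_mult[OF ij(1)] div_mod_less_of_less_mult[OF ij(2)]
    by (simp add: kronecker_mat_index[of _ m m _ n n])
qed (auto simp: kronecker_mat_def)

lemma kronecker_mat_adjoint: "mat_adjoint (kronecker_mat A B) = kronecker_mat (mat_adjoint A) (mat_adjoint B)"
proof (rule eq_matI)
  fix i j assume "i < dim_row (kronecker_mat (mat_adjoint A) (mat_adjoint B))"
    "j < dim_col (kronecker_mat (mat_adjoint A) (mat_adjoint B))"
  then have ij: "i < dim_col A * dim_col B" "j < dim_row A * dim_row B" by (auto simp: kronecker_mat_def)
  then show "mat_adjoint (kronecker_mat A B) $$ (i, j) = kronecker_mat (mat_adjoint A) (mat_adjoint B) $$ (i, j)"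
    using div_mod_less_of_less_mult[OF ij(1)] div_mod_less_of_less_mult[OF ij(2)]
    by (simp add: kronecker_mat_def)
qed (auto simp: kronecker_mat_def)

lemma kronecker_mat_unitary:
  assumes "U \<in> carrier (unitary_group m)" "V \<in> carrier (unitary_group n)"
  shows "kronecker_mat U V \<in> carrier (unitary_group (m * n))"
  using assms
  by (auto simp: unitary_group_carrier kronecker_mat_carrier kronecker_mat_adjoint kronecker_mat_one
      kronecker_mat_mult[of _ m m _ n n _ m _ n])

lemma unitary_rep_tensor:
  assumes G: "Group.monoid G" and \<rho>: "unitary_rep G \<rho>" and \<sigma>: "unitary_rep G \<sigma>"
  shows "unitary_rep G (tensor_rep \<rho> \<sigma>)" "rep_dim G (tensor_rep \<rho> \<sigma>) = rep_dim G \<rho> * rep_dim G \<sigma>"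
proof -
  let ?m = "rep_dim G \<rho>" and ?n = "rep_dim G \<sigma>"
  note c = unitary_rep_carrier[OF G \<rho>] unitary_rep_carrier[OF G \<sigma>]
  have 1: "tensor_rep \<rho> \<sigma> g \<in> carrier (unitary_group (?m * ?n))" if "g \<in> carrier G" for g
    unfolding tensor_rep_def
    by (intro kronecker_mat_unitary unitary_rep_unitary[OF G \<rho> that] unitary_rep_unitary[OF G \<sigma> that])
  have 2: "tensor_rep \<rho> \<sigma> (g \<otimes>\<^bsub>G\<^esub> h) = tensor_rep \<rho> \<sigma> g * tensor_rep \<rho> \<sigma> h" if "g \<in> carrier G" "h \<in> carrier G" for g h
    using that by (simp add: tensor_rep_def unitary_rep_mult[OF G \<rho>] unitary_rep_mult[OF G \<sigma>]
      kronecker_mat_mult[OF c(1) c(2) c(1) c(2)])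
  have 3: "continuous_on (carrier G) (\<lambda>g. tensor_rep \<rho> \<sigma> g $$ (i, j))" if ij: "i < ?m * ?n" "j < ?m * ?n" for i j
  proof -
    have "continuous_on (carrier G) (\<lambda>g. \<rho> g $$ (i div ?n, j div ?n) * \<sigma> g $$ (i mod ?n, j mod ?n))"
      using div_mod_less_of_less_mult[OF ij(1)] div_mod_less_of_less_mult[OF ij(2)]
      by (intro continuous_intros unitary_rep_continuous[OF G \<rho>] unitary_rep_continuous[OF G \<sigma>])
    then show ?thesis
      by (rule continuous_on_eq) (simp add: tensor_rep_def kronecker_mat_index[OF c ij])
  qed
  show "unitary_rep G (tensor_rep \<rho> \<sigma>)" "rep_dim G (tensor_rep \<rho> \<sigma>) = ?m * ?n"
    using unitary_repI[OF G 1 2 3] by blast+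
qed

subsection \<open>Classes of irreducible representations and multiplicities\<close>

lemma rep_equiv_equiv:
  assumes G: "Group.monoid G"
  shows "equiv (irreps G) {(\<rho>, \<sigma>). \<rho> \<in> irreps G \<and> \<sigma> \<in> irreps G \<and> rep_equiv G \<rho> \<sigma>}"
proof -
  have c: "\<rho> g \<in> carrier_mat (rep_dim G \<rho>) (rep_dim G \<rho>)" if "\<rho> \<in> irreps G" "g \<in> carrier G" for \<rho> g
    using that unitary_rep_carrier[OF G] by (auto simp: irreps_def)
  show ?thesis
  proof (rule equivI)
    show "refl_on (irreps G) {(\<rho>, \<sigma>). \<rho> \<in> irreps G \<and> \<sigma> \<in> irreps G \<and> rep_equiv G \<rho> \<sigma>}"
      using rep_equiv_refl[OF G] by (auto simp: refl_on_def irreps_def)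
    show "sym {(\<rho>, \<sigma>). \<rho> \<in> irreps G \<and> \<sigma> \<in> irreps G \<and> rep_equiv G \<rho> \<sigma>}"
      using rep_equiv_sym[of G] c by (auto simp: sym_def)
    show "trans {(\<rho>, \<sigma>). \<rho> \<in> irreps G \<and> \<sigma> \<in> irreps G \<and> rep_equiv G \<rho> \<sigma>}"
    proof (rule transI, clarsimp)
      fix \<rho> \<sigma> \<tau> assume "\<rho> \<in> irreps G" "\<sigma> \<in> irreps G" "\<tau> \<in> irreps G" "rep_equiv G \<rho> \<sigma>" "rep_equiv G \<sigma> \<tau>"
      then show "rep_equiv G \<rho> \<tau>" by (intro rep_equiv_trans[of G \<rho> \<sigma> \<tau>] c)
    qed
  qed auto
qed

lemma Irr_rep_equiv:
  assumes G: "Group.monoid G" and "\<pi> \<in> Irr G" "\<rho> \<in> \<pi>" "\<sigma> \<in> \<pi>"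
  shows "rep_equiv G \<rho> \<sigma>"
  using quotient_eq_iff[OF rep_equiv_equiv[OF G] assms(2)[unfolded Irr_def] assms(2)[unfolded Irr_def] assms(3,4)]
  by simp

lemma Irr_subset: "\<pi> \<in> Irr G \<Longrightarrow> \<pi> \<subseteq> irreps G"
  by (auto simp: Irr_def quotient_def)

lemma irr_rep_mem:
  assumes G: "Group.monoid G" and "\<pi> \<in> Irr G"
  shows "irr_rep \<pi> \<in> \<pi>" "irr_rep \<pi> \<in> irreps G"
proof -
  have "\<pi> \<noteq> {}" using assms(2) in_quotient_imp_non_empty[OF rep_equiv_equiv[OF G]] by (auto simp: Irr_def)
  then show "irr_rep \<pi> \<in> \<pi>" unfolding irr_rep_def by (metis ex_in_conv someI)
  then show "irr_rep \<pi> \<in> irreps G" using Irr_subset[OF assms(2)] by blast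
qed

lemma Irr_eqI:
  assumes G: "Group.monoid G" and "\<pi> \<in> Irr G" "\<pi>' \<in> Irr G" "\<rho> \<in> \<pi>" "\<sigma> \<in> \<pi>'" "rep_equiv G \<rho> \<sigma>"
  shows "\<pi> = \<pi>'"
  using quotient_eqI[OF rep_equiv_equiv[OF G] assms(2,3)[unfolded Irr_def] assms(4,5)] assms Irr_subset[of _ G]
  by blast

lemma irr_dim_pos:
  assumes "Group.monoid G" "\<pi> \<in> Irr G"
  shows "0 < irr_dim G \<pi>"
  using irr_rep_mem(2)[OF assms] by (auto simp: irreps_def irreducible_rep_def Let_def irr_dim_def)

lemma Irr_cover:
  assumes G: "Group.monoid G" and "\<rho> \<in> irreps G"
  obtains \<pi> where "\<pi> \<in> Irr G" "\<rho> \<in> \<pi>"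
  using assms Union_quotient[OF rep_equiv_equiv[OF G]] that unfolding Irr_def by blast

text \<open>\<open>matrix_rows_independent\<close> restated for classes: chosen representatives of
  distinct classes are inequivalent, and grouping the entries by rows gives its index set of
  pairs.\<close>

lemma irr_coefficients_independent:
  assumes G: "Group.monoid G" and F: "finite F" "F \<subseteq> Irr G"
    and rel: "\<And>g. g \<in> carrier G \<Longrightarrow>
      (\<Sum>\<pi>\<in>F. \<Sum>i<irr_dim G \<pi>. \<Sum>j<irr_dim G \<pi>. c \<pi> i j * irr_rep \<pi> g $$ (i, j)) = 0"
    and "\<pi> \<in> F" "i < irr_dim G \<pi>" "j < irr_dim G \<pi>"
  shows "c \<pi> i j = 0"
proof -
  have inj: "inj_on irr_rep F"
    using irr_rep_mem[OF G] Irr_eqI[OF G] Irr_rep_equiv[OF G] F(2) unfolding inj_on_def by (metis subsetD)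
  \<comment> \<open>The coefficients here are indexed by classes, those of the row lemma by
    representations; \<open>k\<close> leads from a representative back to its class.\<close>
  define k where "k = inv_into F irr_rep"
  have k: "k (irr_rep \<pi>) = \<pi>" if "\<pi> \<in> F" for \<pi> using inj that by (simp add: k_def)
  let ?T = "Sigma F (\<lambda>\<pi>. {..<irr_dim G \<pi>})"
  let ?f = "\<lambda>(\<pi>, i). (irr_rep \<pi>, i :: nat)"
  have "c (k (fst (irr_rep \<pi>, i))) (snd (irr_rep \<pi>, i)) j = 0"
  proof (rule matrix_rows_independent[where c = "\<lambda>s. c (k (fst s)) (snd s)", OF G, of "irr_rep ` F" "?f ` ?T"])
    show "irr_rep ` F \<subseteq> irreps G" using irr_rep_mem(2)[OF G] F(2) by blast
    show "\<rho> = \<sigma>" if "\<rho> \<in> irr_rep ` F" "\<sigma> \<in> irr_rep ` F" "rep_equiv G \<rho> \<sigma>" for \<rho> \<sigma>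
      using that Irr_eqI[OF G _ _ irr_rep_mem(1)[OF G] irr_rep_mem(1)[OF G]] F(2) by blast
    show "finite (?f ` ?T)" using F(1) by auto
    show "\<rho> \<in> irr_rep ` F \<and> i < rep_dim G \<rho>" if "(\<rho>, i) \<in> ?f ` ?T" for \<rho> i
      using that by (auto simp: irr_dim_def)
    show "(irr_rep \<pi>, i) \<in> ?f ` ?T" using assms(5,6) by force
    show "j < rep_dim G (fst (irr_rep \<pi>, i))" using assms(7) by (simp add: irr_dim_def)
    fix g assume g: "g \<in> carrier G"
    have "inj_on ?f ?T" using inj by (auto simp: inj_on_def)
    then have "(\<Sum>s\<in>?f ` ?T. \<Sum>j<rep_dim G (fst s). c (k (fst s)) (snd s) j * fst s g $$ (snd s, j))
      = (\<Sum>(\<pi>, i)\<in>?T. \<Sum>j<irr_dim G \<pi>. c \<pi> i j * irr_rep \<pi> g $$ (i, j))"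
      by (subst sum.reindex) (auto simp: k irr_dim_def intro!: sum.cong)
    also have "\<dots> = (\<Sum>\<pi>\<in>F. \<Sum>i<irr_dim G \<pi>. \<Sum>j<irr_dim G \<pi>. c \<pi> i j * irr_rep \<pi> g $$ (i, j))"
      by (subst sum.Sigma) (use F(1) in auto)
    finally show "(\<Sum>s\<in>?f ` ?T. \<Sum>j<rep_dim G (fst s). c (k (fst s)) (snd s) j * fst s g $$ (snd s, j)) = 0"
      using rel[OF g] by simp
  qed
  then show ?thesis using k assms(5) by simp
qed

text \<open>F may contain more classes than occur in the list, so that two decompositions can be
  compared over one common index set.\<close>

lemma sum_list_trace_by_class:
  assumes G: "Group.monoid G" and F: "finite F" "F \<subseteq> Irr G"
    and "\<And>\<rho>. \<rho> \<in> set \<rho>s \<Longrightarrow> \<exists>\<pi>\<in>F. \<rho> \<in> \<pi>" and g: "g \<in> carrier G"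
  shows "(\<Sum>\<rho>\<leftarrow>\<rho>s. mat_trace (\<rho> g))
    = (\<Sum>\<pi>\<in>F. of_nat (length (filter (\<lambda>\<rho>. \<rho> \<in> \<pi>) \<rho>s)) * mat_trace (irr_rep \<pi> g))"
  using assms(4)
proof (induction \<rho>s)
  case (Cons \<rho> \<rho>s)
  obtain \<pi> where \<pi>: "\<pi> \<in> F" "\<rho> \<in> \<pi>" using Cons.prems by auto
  have only: "\<rho> \<in> \<pi>' \<longleftrightarrow> \<pi>' = \<pi>" if "\<pi>' \<in> F" for \<pi>'
    using \<pi> that F(2) Irr_eqI[OF G] Irr_rep_equiv[OF G] by (metis subsetD)
  have c: "\<rho> g \<in> carrier_mat (rep_dim G \<rho>) (rep_dim G \<rho>)" if "\<rho> \<in> irreps G" "g \<in> carrier G" for \<rho> g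
    using that unitary_rep_carrier[OF G] by (auto simp: irreps_def)
  have \<pi>I: "\<pi> \<in> Irr G" using \<pi>(1) F(2) by blast
  have tr: "mat_trace (\<rho> g) = mat_trace (irr_rep \<pi> g)"
    using mat_trace_rep_equiv[OF _ _ Irr_rep_equiv[OF G \<pi>I \<pi>(2) irr_rep_mem(1)[OF G \<pi>I]] g] c
      Irr_subset[OF \<pi>I] \<pi>(2) irr_rep_mem(2)[OF G \<pi>I] by blast
  have "(\<Sum>\<pi>'\<in>F. of_nat (length (filter (\<lambda>\<rho>. \<rho> \<in> \<pi>') (\<rho> # \<rho>s))) * mat_trace (irr_rep \<pi>' g))
    = (\<Sum>\<pi>'\<in>F. (if \<pi>' = \<pi> then mat_trace (irr_rep \<pi>' g) else 0) +
        of_nat (length (filter (\<lambda>\<rho>. \<rho> \<in> \<pi>') \<rho>s)) * mat_trace (irr_rep \<pi>' g))"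
    by (intro sum.cong refl) (auto simp: only algebra_simps)
  also have "\<dots> = mat_trace (\<rho> g) + (\<Sum>\<rho>\<leftarrow>\<rho>s. mat_trace (\<rho> g))"
    using Cons F(1) \<pi>(1) by (simp add: sum.distrib tr)
  finally show ?case by simp
qed simp

text \<open>The uniqueness half of the well-definedness of \<open>multiplicity_rep\<close>. Two
  decompositions have the same trace function; its expression through the coefficients of the
  representatives is unique, and the coefficient of a diagonal entry is the number of summands in
  that class.\<close>

lemma multiplicity_rep_eq:
  assumes G: "Group.monoid G" and \<tau>: "unitary_rep G \<tau>" and \<rho>s: "set \<rho>s \<subseteq> irreps G" "rep_equiv G \<tau> (direct_sum_rep \<rho>s)"
    and \<pi>: "\<pi> \<in> Irr G"
  shows "multiplicity_rep G \<tau> \<pi> = length (filter (\<lambda>\<rho>. \<rho> \<in> \<pi>) \<rho>s)"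
  unfolding multiplicity_rep_def
proof (rule the_equality)
  show "\<exists>\<rho>s'. set \<rho>s' \<subseteq> irreps G \<and> rep_equiv G \<tau> (direct_sum_rep \<rho>s') \<and>
      length (filter (\<lambda>\<rho>. \<rho> \<in> \<pi>) \<rho>s) = length (filter (\<lambda>\<rho>. \<rho> \<in> \<pi>) \<rho>s')"
    using \<rho>s by blast
  fix m assume "\<exists>\<rho>s'. set \<rho>s' \<subseteq> irreps G \<and> rep_equiv G \<tau> (direct_sum_rep \<rho>s') \<and> m = length (filter (\<lambda>\<rho>. \<rho> \<in> \<pi>) \<rho>s')"
  then obtain \<sigma>s where \<sigma>s: "set \<sigma>s \<subseteq> irreps G" "rep_equiv G \<tau> (direct_sum_rep \<sigma>s)"
    and m: "m = length (filter (\<lambda>\<rho>. \<rho> \<in> \<pi>) \<sigma>s)" by blast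
  have c: "\<rho> g \<in> carrier_mat (rep_dim G \<rho>) (rep_dim G \<rho>)" if "\<rho> \<in> irreps G" "g \<in> carrier G" for \<rho> g
    using that unitary_rep_carrier[OF G] by (auto simp: irreps_def)
  have tr: "mat_trace (\<tau> g) = (\<Sum>\<rho>\<leftarrow>\<rho>s. mat_trace (\<rho> g))"
    if "set \<rho>s \<subseteq> irreps G" "rep_equiv G \<tau> (direct_sum_rep \<rho>s)" "g \<in> carrier G" for \<rho>s g
  proof -
    have "mat_trace (\<tau> g) = mat_trace (direct_sum_rep \<rho>s g)"
      using that c by (intro mat_trace_rep_equiv[OF unitary_rep_carrier[OF G \<tau>] direct_sum_rep_carrier]) auto
    then show ?thesis using that c by (simp add: mat_trace_direct_sum_rep[of _ _ G] subset_iff)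
  qed
  have "\<forall>\<rho>\<in>irreps G. \<exists>\<pi>\<in>Irr G. \<rho> \<in> \<pi>" using Irr_cover[OF G] by metis
  then obtain cls where cls: "\<And>\<rho>. \<rho> \<in> irreps G \<Longrightarrow> cls \<rho> \<in> Irr G \<and> \<rho> \<in> cls \<rho>" by metis
  \<comment> \<open>The class \<pi> is inserted explicitly, as it may occur in neither
    decomposition.\<close>
  define F where "F = insert \<pi> (cls ` (set \<rho>s \<union> set \<sigma>s))"
  have F: "finite F" "F \<subseteq> Irr G" using \<pi> \<rho>s \<sigma>s cls by (auto simp: F_def)
  let ?m = "\<lambda>\<pi>. of_nat (length (filter (\<lambda>\<rho>. \<rho> \<in> \<pi>) \<rho>s)) - of_nat (length (filter (\<lambda>\<rho>. \<rho> \<in> \<pi>) \<sigma>s)) :: complex"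
  have \<pi>F: "\<pi> \<in> F" by (simp add: F_def)
  note dim_pos = irr_dim_pos[OF G \<pi>]
  \<comment> \<open>The coefficient function \<open>if i = j then ?m \<pi> else 0\<close> expresses
    the difference of the traces through matrix entries; it is read off at i = j = 0, an index
    available because dimensions are positive. The unsimplified form lets the rule unify.\<close>
  have "(if (0 :: nat) = 0 then ?m \<pi> else 0) = 0"
  proof (rule irr_coefficients_independent[where c = "\<lambda>\<pi> i j. if i = j then ?m \<pi> else 0", OF G F _ \<pi>F dim_pos dim_pos])
    fix g assume g: "g \<in> carrier G"
    have "(\<Sum>\<pi>\<in>F. \<Sum>i<irr_dim G \<pi>. \<Sum>j<irr_dim G \<pi>. (if i = j then ?m \<pi> else 0) * irr_rep \<pi> g $$ (i, j))
      = (\<Sum>\<pi>\<in>F. ?m \<pi> * mat_trace (irr_rep \<pi> g))"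
    proof (rule sum.cong[OF refl])
      fix \<pi> assume "\<pi> \<in> F"
      then have "dim_row (irr_rep \<pi> g) = irr_dim G \<pi>"
        using c[OF irr_rep_mem(2)[OF G] g, of \<pi>] F(2) by (auto simp: irr_dim_def)
      moreover have "(\<Sum>j<irr_dim G \<pi>. (if i = j then ?m \<pi> else 0) * irr_rep \<pi> g $$ (i, j)) = ?m \<pi> * irr_rep \<pi> g $$ (i, i)"
        if "i < irr_dim G \<pi>" for i
      proof -
        have "(\<Sum>j<irr_dim G \<pi>. (if i = j then ?m \<pi> else 0) * irr_rep \<pi> g $$ (i, j))
          = (\<Sum>j<irr_dim G \<pi>. if i = j then ?m \<pi> * irr_rep \<pi> g $$ (i, j) else 0)" by (intro sum.cong) auto
        then show ?thesis using that by simp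
      qed
      ultimately show "(\<Sum>i<irr_dim G \<pi>. \<Sum>j<irr_dim G \<pi>. (if i = j then ?m \<pi> else 0) * irr_rep \<pi> g $$ (i, j))
        = ?m \<pi> * mat_trace (irr_rep \<pi> g)"
        by (simp add: mat_trace_def sum_distrib_left)
    qed
    also have "\<dots> = (\<Sum>\<rho>\<leftarrow>\<rho>s. mat_trace (\<rho> g)) - (\<Sum>\<rho>\<leftarrow>\<sigma>s. mat_trace (\<rho> g))"
    proof -
      have "\<And>\<rho>. \<rho> \<in> set \<rho>s \<Longrightarrow> \<exists>\<pi>\<in>F. \<rho> \<in> \<pi>" "\<And>\<rho>. \<rho> \<in> set \<sigma>s \<Longrightarrow> \<exists>\<pi>\<in>F. \<rho> \<in> \<pi>"
        using cls \<rho>s(1) \<sigma>s(1) by (auto simp: F_def)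
      then show ?thesis
        using sum_list_trace_by_class[OF G F _ g] by (simp add: left_diff_distrib sum_subtractf)
    qed
    also have "\<dots> = 0" using tr[OF \<rho>s g] tr[OF \<sigma>s g] by simp
    finally show "(\<Sum>\<pi>\<in>F. \<Sum>i<irr_dim G \<pi>. \<Sum>j<irr_dim G \<pi>. (if i = j then ?m \<pi> else 0) * irr_rep \<pi> g $$ (i, j)) = 0" .
  qed
  then show "m = length (filter (\<lambda>\<rho>. \<rho> \<in> \<pi>) \<rho>s)" using m by simp
qed

subsection \<open>Function spaces\<close>

text \<open>Together with the pointwise addition of functions this gives an instance of the abstract
  vector space locale, and with it the bound on the size of independent sets.\<close>

definition fun_scale :: "complex \<Rightarrow> ('a \<Rightarrow> complex) \<Rightarrow> 'a \<Rightarrow> complex" where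
  "fun_scale c f = (\<lambda>x. c * f x)"

interpretation fun_space: vector_space "fun_scale :: complex \<Rightarrow> ('a \<Rightarrow> complex) \<Rightarrow> 'a \<Rightarrow> complex"
  by standard (auto simp: fun_scale_def fun_eq_iff algebra_simps)

lemma sum_fun_apply: "(\<Sum>i\<in>I. f i) x = (\<Sum>i\<in>I. (f i x :: complex))"
  by (induction I rule: infinite_finite_induct) auto

lemma fun_space_span_lincomb:
  assumes "\<And>i. i \<in> I \<Longrightarrow> f i \<in> fun_space.span M" and "\<And>x. h x = (\<Sum>i\<in>I. c i * f i x)"
  shows "h \<in> fun_space.span M"
proof -
  have "h = (\<Sum>i\<in>I. fun_scale (c i) (f i))"
    by (rule ext) (simp add: assms(2) sum_fun_apply fun_scale_def)
  then show ?thesis using assms(1) by (auto intro!: fun_space.span_sum fun_space.span_scale)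
qed

text \<open>Multiplication is bilinear, so it is enough to treat generators: one span induction for
  each factor.\<close>

lemma fun_space_span_mult:
  assumes "f \<in> fun_space.span A" "h \<in> fun_space.span B"
    and AB: "\<And>a b. a \<in> A \<Longrightarrow> b \<in> B \<Longrightarrow> (\<lambda>x. a x * b x) \<in> M"
  shows "(\<lambda>x. f x * h x) \<in> fun_space.span M"
proof -
  have *: "(\<lambda>x. a x * h x) \<in> fun_space.span M" if a: "a \<in> A" for a
    using assms(2)
  proof (induction rule: fun_space.span_induct_alt)
    case base
    have "(\<lambda>x. a x * (0 :: 'a \<Rightarrow> complex) x) = 0" by (auto simp: fun_eq_iff)
    then show ?case using fun_space.span_zero by simp
  next
    case (step c b h)
    have "(\<lambda>x. a x * (fun_scale c b + h) x) = fun_scale c (\<lambda>x. a x * b x) + (\<lambda>x. a x * h x)"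
      by (auto simp: fun_eq_iff fun_scale_def algebra_simps)
    then show ?case using step AB[OF a]
      by (simp add: fun_space.span_add fun_space.span_scale fun_space.span_base)
  qed
  show ?thesis
    using assms(1)
  proof (induction rule: fun_space.span_induct_alt)
    case base
    have "(\<lambda>x. (0 :: 'a \<Rightarrow> complex) x * h x) = 0" by (auto simp: fun_eq_iff)
    then show ?case using fun_space.span_zero by simp
  next
    case (step c b f)
    have "(\<lambda>x. (fun_scale c b + f) x * h x) = fun_scale c (\<lambda>x. b x * h x) + (\<lambda>x. f x * h x)"
      by (auto simp: fun_eq_iff fun_scale_def algebra_simps)
    then show ?case using step *
      by (simp add: fun_space.span_add fun_space.span_scale)
  qed
qed

text \<open>Independence is assumed for the indexed family, so members cannot repeat: f i = f j
  would give the relation with coefficients 1 and -1. Hence the image has as many elements as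
  \<open>I\<close>, and the bound for independent sets in a finitely generated span counts
  \<open>I\<close> itself.\<close>

lemma fun_space_card_le:
  fixes f :: "'i \<Rightarrow> 'a \<Rightarrow> complex"
  assumes "finite I" "finite M" and span: "\<And>i. i \<in> I \<Longrightarrow> f i \<in> fun_space.span M"
    and indep: "\<And>c i. (\<And>x. (\<Sum>i\<in>I. c i * f i x) = 0) \<Longrightarrow> i \<in> I \<Longrightarrow> c i = 0"
  shows "card I \<le> card M"
proof -
  have inj: "inj_on f I"
  proof (rule inj_onI, rule ccontr)
    fix i j assume ij: "i \<in> I" "j \<in> I" "f i = f j" "i \<noteq> j"
    let ?c = "\<lambda>k. if k = i then 1 else if k = j then -1 else 0 :: complex"
    have "(\<Sum>k\<in>I. ?c k * f k x) = 0" for x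
    proof -
      have "(\<Sum>k\<in>I. ?c k * f k x) = (\<Sum>k\<in>I. (if k = i then f k x else 0) - (if k = j then f k x else 0))"
        using ij(4) by (intro sum.cong) auto
      also have "\<dots> = f i x - f j x" using ij assms(1) by (simp add: sum_subtractf)
      also have "\<dots> = 0" unfolding ij(3) by simp
      finally show ?thesis .
    qed
    then have "?c i = 0" using indep[of ?c i] ij(1) by blast
    then show False by simp
  qed
  have "fun_space.independent (f ` I)"
  proof (rule fun_space.independent_if_scalars_zero)
    show "finite (f ` I)" using assms(1) by simp
    fix u v assume u: "(\<Sum>x\<in>f ` I. fun_scale (u x) x) = 0" and "v \<in> f ` I"
    then obtain i where i: "i \<in> I" "v = f i" by blast
    have "(\<Sum>i\<in>I. u (f i) * f i x) = 0" for x
    proof -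
      have "(\<Sum>i\<in>I. u (f i) * f i x) = (\<Sum>y\<in>f ` I. fun_scale (u y) y) x"
        by (simp add: sum_fun_apply sum.reindex[OF inj] fun_scale_def)
      then show ?thesis using u by simp
    qed
    then show "u v = 0" using indep[of "\<lambda>i. u (f i)" i] i by simp
  qed
  then have "card (f ` I) \<le> card M"
    using fun_space.independent_span_bound[OF assms(2)] span by blast
  then show ?thesis by (simp add: card_image[OF inj])
qed

subsection \<open>Spans of matrix coefficients\<close>

text \<open>Values of a representation off the carrier are junk, hence cut off.\<close>
definition coefficient :: "'a monoid \<Rightarrow> ('a \<Rightarrow> complex mat) \<Rightarrow> nat \<Rightarrow> nat \<Rightarrow> 'a \<Rightarrow> complex" where
  "coefficient G \<rho> i j = (\<lambda>g. if g \<in> carrier G then \<rho> g $$ (i, j) else 0)"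

definition coefficients :: "'a monoid \<Rightarrow> ('a \<Rightarrow> complex mat) \<Rightarrow> ('a \<Rightarrow> complex) set" where
  "coefficients G \<rho> = (\<lambda>(i, j). coefficient G \<rho> i j) ` ({..<rep_dim G \<rho>} \<times> {..<rep_dim G \<rho>})"

lemma coefficientsI: "i < rep_dim G \<rho> \<Longrightarrow> j < rep_dim G \<rho> \<Longrightarrow> coefficient G \<rho> i j \<in> coefficients G \<rho>"
  by (auto simp: coefficients_def)

lemma finite_coefficients [simp]: "finite (coefficients G \<rho>)"
  by (simp add: coefficients_def)

text \<open>From \<sigma>(g) = U \<rho>(g) U* each entry of \<sigma> is a combination of entries of
  \<rho> with coefficients that do not depend on g.\<close>

lemma coefficients_rep_equiv:
  assumes c: "\<And>g. g \<in> carrier G \<Longrightarrow> \<rho> g \<in> carrier_mat (rep_dim G \<rho>) (rep_dim G \<rho>)"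
    "\<And>g. g \<in> carrier G \<Longrightarrow> \<sigma> g \<in> carrier_mat (rep_dim G \<sigma>) (rep_dim G \<sigma>)"
    and "rep_equiv G \<rho> \<sigma>"
  shows "coefficients G \<sigma> \<subseteq> fun_space.span (coefficients G \<rho>)"
proof -
  let ?n = "rep_dim G \<rho>"
  from assms(3) obtain U where U: "U \<in> carrier (unitary_group ?n)"
    "\<And>g. g \<in> carrier G \<Longrightarrow> U * \<rho> g = \<sigma> g * U" and n: "rep_dim G \<sigma> = ?n"
    by (rule rep_equivE) blast
  have Uc: "U \<in> carrier_mat ?n ?n" "mat_adjoint U \<in> carrier_mat ?n ?n" using U(1) by (auto simp: unitary_group_carrier)
  have "coefficient G \<sigma> i j \<in> fun_space.span (coefficients G \<rho>)" if ij: "i < ?n" "j < ?n" for i j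
  proof (rule fun_space_span_lincomb[where I = "{..<?n} \<times> {..<?n}"
        and f = "\<lambda>t. coefficient G \<rho> (fst t) (snd t)" and c = "\<lambda>t. U $$ (i, fst t) * mat_adjoint U $$ (snd t, j)"])
    fix g
    show "coefficient G \<sigma> i j g =
      (\<Sum>t\<in>{..<?n} \<times> {..<?n}. U $$ (i, fst t) * mat_adjoint U $$ (snd t, j) * coefficient G \<rho> (fst t) (snd t) g)"
    proof (cases "g \<in> carrier G")
      case g: True
      note r = c(1)[OF g] c(2)[OF g, unfolded n]
      have "\<sigma> g = \<sigma> g * (U * mat_adjoint U)" using r by (simp add: unitary_group_right[OF U(1)])
      also have "\<dots> = (U * \<rho> g) * mat_adjoint U"
        unfolding U(2)[OF g] using r Uc by (simp add: assoc_mult_mat[of _ ?n ?n _ ?n _ ?n])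
      finally have "\<sigma> g $$ (i, j) = ((U * \<rho> g) * mat_adjoint U) $$ (i, j)" by simp
      also have "\<dots> = (\<Sum>l<?n. (\<Sum>k<?n. U $$ (i, k) * \<rho> g $$ (k, l)) * mat_adjoint U $$ (l, j))"
        using ij by (simp add: mat_mult_index[OF mult_carrier_mat[OF Uc(1) r(1)] Uc(2)] mat_mult_index[OF Uc(1) r(1)]
          del: index_mult_mat(1))
      also have "\<dots> = (\<Sum>k<?n. \<Sum>l<?n. U $$ (i, k) * mat_adjoint U $$ (l, j) * \<rho> g $$ (k, l))"
        by (subst sum.swap) (simp add: sum_distrib_left sum_distrib_right mult_ac)
      finally show ?thesis using g by (simp add: coefficient_def sum.cartesian_product case_prod_unfold del: mat_adjoint_index)
    qed (simp add: coefficient_def)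
  qed (auto intro!: fun_space.span_base coefficientsI)
  then show ?thesis by (auto simp: coefficients_def n)
qed

lemma coefficients_direct_sum:
  assumes "\<And>\<rho> g. \<rho> \<in> set \<rho>s \<Longrightarrow> g \<in> carrier G \<Longrightarrow> \<rho> g \<in> carrier_mat (rep_dim G \<rho>) (rep_dim G \<rho>)" "\<sigma> \<in> set \<rho>s"
  shows "coefficients G \<sigma> \<subseteq> coefficients G (direct_sum_rep \<rho>s)"
proof -
  obtain k where k: "k + rep_dim G \<sigma> \<le> rep_dim G (direct_sum_rep \<rho>s)"
    "\<forall>g\<in>carrier G. \<forall>i<rep_dim G \<sigma>. \<forall>j<rep_dim G \<sigma>. direct_sum_rep \<rho>s g $$ (k + i, k + j) = \<sigma> g $$ (i, j)"
    using direct_sum_rep_coefficient[of \<rho>s G \<sigma>] assms by blast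
  have "coefficient G \<sigma> i j = coefficient G (direct_sum_rep \<rho>s) (k + i) (k + j)"
    if "i < rep_dim G \<sigma>" "j < rep_dim G \<sigma>" for i j
    using k(2) that by (auto simp: coefficient_def)
  then show ?thesis using k(1) by (auto simp: coefficients_def intro!: coefficientsI[unfolded coefficients_def])
qed

lemma coefficients_tensor:
  assumes G: "Group.monoid G" and "unitary_rep G \<rho>" "unitary_rep G \<sigma>" and f: "f \<in> coefficients G (tensor_rep \<rho> \<sigma>)"
  obtains a b where "a \<in> coefficients G \<rho>" "b \<in> coefficients G \<sigma>" "f = (\<lambda>x. a x * b x)"
proof -
  let ?m = "rep_dim G \<rho>" and ?n = "rep_dim G \<sigma>"
  obtain i j where ij: "i < ?m * ?n" "j < ?m * ?n" and fij: "f = coefficient G (tensor_rep \<rho> \<sigma>) i j"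
    using f unitary_rep_tensor(2)[OF assms(1-3)] by (auto simp: coefficients_def)
  have "f = (\<lambda>g. coefficient G \<rho> (i div ?n) (j div ?n) g * coefficient G \<sigma> (i mod ?n) (j mod ?n) g)"
    using kronecker_mat_index[OF unitary_rep_carrier[OF assms(1,2)] unitary_rep_carrier[OF assms(1,3)] ij]
    by (auto simp: fij coefficient_def tensor_rep_def fun_eq_iff)
  then show ?thesis
    by (rule that[OF coefficientsI coefficientsI, rotated -1])
      (use div_mod_less_of_less_mult[OF ij(1)] div_mod_less_of_less_mult[OF ij(2)] in simp_all)
qed

text \<open>The passage from multiplicities to function spaces. Some decomposition of \<tau> has a
  summand in \<pi>; its coefficients are among those of the direct sum, and equivalence preserves
  spans on both sides.\<close>

lemma coefficients_of_constituent:
  assumes G: "Group.monoid G" and \<tau>: "unitary_rep G \<tau>" and \<pi>: "\<pi> \<in> Irr G" and "multiplicity_rep G \<tau> \<pi> \<noteq> 0"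
  shows "coefficients G (irr_rep \<pi>) \<subseteq> fun_space.span (coefficients G \<tau>)"
proof -
  obtain \<rho>s where \<rho>s: "set \<rho>s \<subseteq> irreps G" "rep_equiv G \<tau> (direct_sum_rep \<rho>s)"
    using complete_reducibility[OF G \<tau>] by blast
  then obtain \<rho> where \<rho>: "\<rho> \<in> set \<rho>s" "\<rho> \<in> \<pi>"
    using assms(4) multiplicity_rep_eq[OF G \<tau> \<rho>s \<pi>] by (auto simp: filter_empty_conv)
  have c: "\<rho> g \<in> carrier_mat (rep_dim G \<rho>) (rep_dim G \<rho>)" if "\<rho> \<in> irreps G" "g \<in> carrier G" for \<rho> g
    using that unitary_rep_carrier[OF G] by (auto simp: irreps_def)
  have "coefficients G (direct_sum_rep \<rho>s) \<subseteq> fun_space.span (coefficients G \<tau>)"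
    using \<rho>s c by (intro coefficients_rep_equiv[OF unitary_rep_carrier[OF G \<tau>] direct_sum_rep_carrier]) auto
  moreover have "coefficients G \<rho> \<subseteq> coefficients G (direct_sum_rep \<rho>s)"
    using \<rho>(1) \<rho>s(1) c by (intro coefficients_direct_sum) auto
  moreover have "coefficients G (irr_rep \<pi>) \<subseteq> fun_space.span (coefficients G \<rho>)"
    using \<rho> \<rho>s(1) c irr_rep_mem[OF G \<pi>] Irr_rep_equiv[OF G \<pi>]
    by (intro coefficients_rep_equiv) auto
  ultimately show ?thesis
    by (meson fun_space.span_mono fun_space.span_minimal fun_space.subspace_span subset_trans)
qed

subsection \<open>Polynomial growth\<close>

text \<open>Each exponent ranges separately up to \<open>n\<close>, which bounds the count by a
  plain power of \<open>n + 1\<close>; products of n members of \<open>C\<close> are included.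
  Functions vanish off \<open>X\<close> to match the cut-off in \<open>coefficient\<close>.\<close>

definition monomials :: "'a set \<Rightarrow> ('a \<Rightarrow> complex) set \<Rightarrow> nat \<Rightarrow> ('a \<Rightarrow> complex) set" where
  "monomials X C n = (\<lambda>e g. if g \<in> X then \<Prod>f\<in>C. f g ^ e f else 0) ` (C \<rightarrow>\<^sub>E {..n})"

lemma finite_monomials: "finite C \<Longrightarrow> finite (monomials X C n)"
  by (simp add: monomials_def finite_PiE)

lemma card_monomials_le:
  assumes "finite C"
  shows "card (monomials X C n) \<le> (n + 1) ^ card C"
proof -
  have "card (monomials X C n) \<le> card (C \<rightarrow>\<^sub>E {..n})"
    unfolding monomials_def by (intro card_image_le finite_PiE assms) auto
  then show ?thesis by (simp add: card_funcsetE assms)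
qed

lemma monomials_Suc:
  assumes "finite C" "f \<in> C" "h \<in> monomials X C n"
  shows "(\<lambda>x. f x * h x) \<in> monomials X C (Suc n)"
proof -
  obtain e where e: "e \<in> C \<rightarrow>\<^sub>E {..n}" "h = (\<lambda>g. if g \<in> X then \<Prod>f\<in>C. f g ^ e f else 0)"
    using assms(3) by (auto simp: monomials_def)
  let ?e = "e(f := Suc (e f))"
  have "?e \<in> C \<rightarrow>\<^sub>E {..Suc n}" using e(1) assms(2) by (auto simp: PiE_def Pi_def extensional_def le_SucI)
  moreover have "f g * (\<Prod>k\<in>C. k g ^ e k) = (\<Prod>k\<in>C. k g ^ ?e k)" for g
  proof -
    have "(\<Prod>k\<in>C - {f}. k g ^ ?e k) = (\<Prod>k\<in>C - {f}. k g ^ e k)" by (intro prod.cong) auto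
    then show ?thesis by (simp add: prod.remove[OF assms(1,2)] mult_ac)
  qed
  ultimately show ?thesis
    unfolding monomials_def e(2) by (intro image_eqI[of _ _ ?e]) auto
qed

text \<open>The left side counts the triples (\<pi>, i, j), that is, the matrix coefficients of the
  classes in F, and these are independent elements of the span of \<open>M\<close>.\<close>

lemma sum_irr_dim_square_le:
  assumes G: "Group.monoid G" and F: "finite F" "F \<subseteq> Irr G" and "finite M"
    and span: "\<And>\<pi>. \<pi> \<in> F \<Longrightarrow> coefficients G (irr_rep \<pi>) \<subseteq> fun_space.span M"
  shows "(\<Sum>\<pi>\<in>F. (irr_dim G \<pi>)\<^sup>2) \<le> card M"
proof -
  let ?d = "irr_dim G"
  let ?I = "Sigma F (\<lambda>\<pi>. {..<?d \<pi>} \<times> {..<?d \<pi>})"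
  have sum: "(\<Sum>(\<pi>, i, j)\<in>?I. h \<pi> i j) = (\<Sum>\<pi>\<in>F. \<Sum>i<?d \<pi>. \<Sum>j<?d \<pi>. h \<pi> i j)" for h :: "_ \<Rightarrow> _ \<Rightarrow> _ \<Rightarrow> complex"
  proof -
    have "(\<Sum>\<pi>\<in>F. \<Sum>i<?d \<pi>. \<Sum>j<?d \<pi>. h \<pi> i j) = (\<Sum>\<pi>\<in>F. \<Sum>(i, j)\<in>{..<?d \<pi>} \<times> {..<?d \<pi>}. h \<pi> i j)"
      by (simp only: sum.cartesian_product)
    also have "\<dots> = (\<Sum>(\<pi>, i, j)\<in>?I. h \<pi> i j)" by (rule sum.Sigma) (use F(1) in auto)
    finally show ?thesis by (rule sym)
  qed
  have "card ?I \<le> card M"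
  proof (rule fun_space_card_le[of _ _ "\<lambda>(\<pi>, i, j). coefficient G (irr_rep \<pi>) i j"])
    show "finite ?I" "finite M" using F(1) assms(4) by auto
    show "(\<lambda>(\<pi>, i, j). coefficient G (irr_rep \<pi>) i j) t \<in> fun_space.span M" if "t \<in> ?I" for t
      using that span by (auto simp: irr_dim_def intro!: coefficientsI subsetD[OF span])
    fix c t assume rel: "\<And>x. (\<Sum>t\<in>?I. c t * (\<lambda>(\<pi>, i, j). coefficient G (irr_rep \<pi>) i j) t x) = 0" and t: "t \<in> ?I"
    obtain \<pi> i j where t': "t = (\<pi>, i, j)" "\<pi> \<in> F" "i < ?d \<pi>" "j < ?d \<pi>" using t by auto
    have "c (\<pi>, i, j) = 0"
    proof (rule irr_coefficients_independent[where c = "\<lambda>\<pi> i j. c (\<pi>, i, j)", OF G F _ t'(2-4)])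
      fix g assume "g \<in> carrier G"
      then have "(\<Sum>\<pi>\<in>F. \<Sum>i<?d \<pi>. \<Sum>j<?d \<pi>. c (\<pi>, i, j) * irr_rep \<pi> g $$ (i, j))
        = (\<Sum>(\<pi>, i, j)\<in>?I. c (\<pi>, i, j) * coefficient G (irr_rep \<pi>) i j g)"
        by (subst sum) (simp add: coefficient_def)
      also have "\<dots> = 0" using rel[of g] by (simp add: case_prod_unfold)
      finally show "(\<Sum>\<pi>\<in>F. \<Sum>i<?d \<pi>. \<Sum>j<?d \<pi>. c (\<pi>, i, j) * irr_rep \<pi> g $$ (i, j)) = 0" .
    qed
    then show "c t = 0" by (simp add: t')
  qed
  moreover have "card ?I = (\<Sum>\<pi>\<in>F. (?d \<pi>)\<^sup>2)"
    using F(1) by (simp add: card_SigmaI power2_eq_square)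
  ultimately show ?thesis by simp
qed

section \<open>The trivial class and the growth argument\<close>

lemma trivial_rep_irrep:
  assumes G: "Group.monoid G"
  shows "(\<lambda>_. 1\<^sub>m 1) \<in> irreps G" "rep_dim G (\<lambda>_. 1\<^sub>m 1) = 1"
proof -
  have u: "unitary_rep G (\<lambda>_. 1\<^sub>m 1)" "rep_dim G (\<lambda>_. 1\<^sub>m 1) = 1"
    by (rule unitary_repI[OF G]; auto simp: unitary_group_carrier)+
  have "W = {0\<^sub>v 1} \<or> W = carrier_vec 1" if W: "vec_subspace 1 W" for W
  proof (cases "W = {0\<^sub>v 1}")
    case False
    have W': "W \<subseteq> carrier_vec 1" "0\<^sub>v 1 \<in> W" "\<And>c v. v \<in> W \<Longrightarrow> c \<cdot>\<^sub>v v \<in> W" using W by (auto simp: vec_subspace_iff)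
    then obtain w where w: "w \<in> W" "w \<noteq> 0\<^sub>v 1" using False by blast
    have wc: "w \<in> carrier_vec 1" using w W' by blast
    then have "w $ 0 \<noteq> 0" using w(2) by (auto simp: vec_eq_iff)
    have "v \<in> W" if "v \<in> carrier_vec 1" for v
    proof -
      have "v = (v $ 0 / w $ 0) \<cdot>\<^sub>v w" using that wc \<open>w $ 0 \<noteq> 0\<close> by (intro eq_vecI) auto
      then show ?thesis using W'(3)[OF w(1)] by metis
    qed
    then show ?thesis using W' by blast
  qed simp
  then show "(\<lambda>_. 1\<^sub>m 1) \<in> irreps G" using u by (auto simp: irreps_def irreducible_rep_def)
  show "rep_dim G (\<lambda>_. 1\<^sub>m 1) = 1" by fact
qed

lemma emeasure_irr_haar:
  assumes "finite V" "V \<subseteq> Irr G"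
  shows "emeasure (irr_haar G) V = of_nat (\<Sum>\<pi>\<in>V. (irr_dim G \<pi>)\<^sup>2)"
  unfolding irr_haar_def using assms by (simp add: emeasure_point_measure_finite2)

lemma irr_leptin_monoid:
  assumes G: "Group.monoid G" and "D \<ge> 1"
  shows "irr_leptin G D"
  unfolding irr_leptin_def
proof (intro allI impI, elim conjE)
  fix K and \<epsilon> :: real
  assume K: "K \<subseteq> Irr G" "finite K" and \<epsilon>: "\<epsilon> > 0"
  define haar where "haar V = (\<Sum>\<pi>\<in>V. (irr_dim G \<pi>)\<^sup>2)" for V
  obtain \<pi>\<^sub>0 where \<pi>\<^sub>0: "\<pi>\<^sub>0 \<in> Irr G" "(\<lambda>_. 1\<^sub>m 1) \<in> \<pi>\<^sub>0" using Irr_cover[OF G trivial_rep_irrep(1)[OF G]] .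
  define V where "V n = (irr_prod G K ^^ n) {\<pi>\<^sub>0}" for n
  have V0: "V 0 = {\<pi>\<^sub>0}" and VS: "V (Suc n) = irr_prod G K (V n)" for n by (simp_all add: V_def)
  define C where "C = (\<Union>\<kappa>\<in>K. coefficients G (irr_rep \<kappa>))"
  define M where "M = monomials (carrier G) C"
  have C: "finite C" using K by (auto simp: C_def)
  have c: "\<rho> g \<in> carrier_mat (rep_dim G \<rho>) (rep_dim G \<rho>)" if "\<rho> \<in> irreps G" "g \<in> carrier G" for \<rho> g
    using that unitary_rep_carrier[OF G] by (auto simp: irreps_def)
  have u: "unitary_rep G (irr_rep \<pi>)" if "\<pi> \<in> Irr G" for \<pi> using irr_rep_mem(2)[OF G that] by (simp add: irreps_def)
  have VI: "V n \<subseteq> Irr G" for n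
    by (cases n) (use \<pi>\<^sub>0 in \<open>auto simp: V0 VS irr_prod_def\<close>)
  have span: "coefficients G (irr_rep \<pi>) \<subseteq> fun_space.span (M n)" if "\<pi> \<in> V n" for \<pi> n
    using that
  proof (induction n arbitrary: \<pi>)
    case 0
    then have \<pi>: "\<pi> = \<pi>\<^sub>0" by (simp add: V0)
    have "coefficients G (irr_rep \<pi>) \<subseteq> fun_space.span (coefficients G (\<lambda>_. 1\<^sub>m 1))"
      unfolding \<pi> using irr_rep_mem[OF G \<pi>\<^sub>0(1)] Irr_rep_equiv[OF G \<pi>\<^sub>0] trivial_rep_irrep(1)[OF G] c
      by (intro coefficients_rep_equiv) auto
    moreover have "coefficients G (\<lambda>_. 1\<^sub>m 1) \<subseteq> M 0"
    proof -
      \<comment> \<open>The function 1 on the carrier is the monomial with all exponents 0;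
        \<open>restrict\<close> makes the exponent function extensional, as membership in the
        function set requires.\<close>
      have one: "coefficient G (\<lambda>_. 1\<^sub>m 1) 0 0 = (\<lambda>g. if g \<in> carrier G then \<Prod>f\<in>C. f g ^ restrict (\<lambda>_. 0) C f else 0)"
        by (auto simp: coefficient_def fun_eq_iff)
      have "coefficient G (\<lambda>_. 1\<^sub>m 1) 0 0 \<in> M 0"
        unfolding M_def monomials_def by (rule image_eqI[where x = "restrict (\<lambda>_. 0) C"], simp only: one) auto
      moreover have "coefficients G (\<lambda>_. 1\<^sub>m 1) = {coefficient G (\<lambda>_. 1\<^sub>m 1) 0 0}"
        unfolding coefficients_def trivial_rep_irrep(2)[OF G] by (simp add: lessThan_Suc)
      ultimately show ?thesis by simp
    qed
    ultimately show ?case using fun_space.span_mono by blast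
  next
    case (Suc n)
    then obtain \<kappa> \<nu> where \<kappa>: "\<kappa> \<in> K" and \<nu>: "\<nu> \<in> V n" and \<pi>: "\<pi> \<in> Irr G" and nz: "irr_conv G \<kappa> \<nu> \<pi> \<noteq> 0"
      by (auto simp: VS irr_prod_def)
    have \<kappa>I: "\<kappa> \<in> Irr G" and \<nu>I: "\<nu> \<in> Irr G" using \<kappa> \<nu> K VI by auto
    let ?\<tau> = "tensor_rep (irr_rep \<kappa>) (irr_rep \<nu>)"
    have "multiplicity_rep G ?\<tau> \<pi> \<noteq> 0" using nz by (auto simp: irr_conv_def)
    then have "coefficients G (irr_rep \<pi>) \<subseteq> fun_space.span (coefficients G ?\<tau>)"
      by (rule coefficients_of_constituent[OF G unitary_rep_tensor(1)[OF G u[OF \<kappa>I] u[OF \<nu>I]] \<pi>])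
    \<comment> \<open>Tensoring with a class in K multiplies an element of the span of
      \<open>M n\<close> by a member of \<open>C\<close>, which raises one exponent by one.\<close>
    moreover have "f \<in> fun_space.span (M (Suc n))" if f: "f \<in> coefficients G ?\<tau>" for f
    proof -
      obtain a b where ab: "a \<in> coefficients G (irr_rep \<kappa>)" "b \<in> coefficients G (irr_rep \<nu>)" "f = (\<lambda>x. a x * b x)"
        using coefficients_tensor[OF G u[OF \<kappa>I] u[OF \<nu>I] f] .
      have "a \<in> C" using ab(1) \<kappa> by (auto simp: C_def)
      show ?thesis unfolding ab(3)
        by (rule fun_space_span_mult[of _ C _ "M n"])
          (use \<open>a \<in> C\<close> Suc.IH[OF \<nu>] ab(2) monomials_Suc[OF C] in \<open>auto simp: M_def intro: fun_space.span_base\<close>)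
    qed
    ultimately show ?case by (meson fun_space.span_minimal fun_space.subspace_span subsetI subset_trans)
  qed
  \<comment> \<open>Stated for finite subsets because the finiteness of \<open>V n\<close> is not
    known yet; it is deduced from this bound.\<close>
  have bound: "haar F \<le> (n + 1) ^ card C" if "finite F" "F \<subseteq> V n" for F n
  proof -
    have "haar F \<le> card (M n)"
      unfolding haar_def using that VI[of n] span[of _ n] finite_monomials[OF C]
      by (intro sum_irr_dim_square_le[OF G]) (auto simp: M_def)
    then show ?thesis using card_monomials_le[OF C, of "carrier G" n] by (simp add: M_def)
  qed
  \<comment> \<open>Every class weighs at least 1, so a finite subset with more than
    \<open>(n + 1) ^ card C\<close> elements would exceed the bound.\<close>
  have fin: "finite (V n)" for n
  proof (rule ccontr)
    assume "infinite (V n)"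
    then obtain F where F: "finite F" "F \<subseteq> V n" "card F = Suc ((n + 1) ^ card C)"
      using infinite_arbitrarily_large by blast
    have "card F \<le> haar F"
      unfolding haar_def card_eq_sum using irr_dim_pos[OF G] F(2) VI[of n]
      by (intro sum_mono) (simp add: Suc_le_eq subset_iff)
    then show False using bound[OF F(1,2)] F(3) by simp
  qed
  have haar: "emeasure (irr_haar G) (V n) = of_nat (haar (V n))" for n
    unfolding haar_def by (rule emeasure_irr_haar[OF fin VI])
  show "\<exists>V\<subseteq>Irr G. 0 < emeasure (irr_haar G) V \<and> emeasure (irr_haar G) V < \<infinity> \<and>
      emeasure (irr_haar G) (irr_prod G K V) / emeasure (irr_haar G) V < of_nat D + ennreal \<epsilon>"
  proof (rule ccontr)
    assume contra: "\<not> ?thesis"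
    \<comment> \<open>Positive and finite measure makes \<open>V n\<close> an admissible candidate,
      so its failure bounds the quotient from below by D + \<epsilon>, which is at least 1 +
      \<epsilon>.\<close>
    have step: "(1 + \<epsilon>) * real (haar (V n)) \<le> real (haar (V (Suc n)))" if pos: "haar (V n) > 0" for n
    proof -
      have "\<not> emeasure (irr_haar G) (V (Suc n)) / emeasure (irr_haar G) (V n) < of_nat D + ennreal \<epsilon>"
      proof -
        have "0 < emeasure (irr_haar G) (V n)" unfolding haar using pos by simp
        moreover have "emeasure (irr_haar G) (V n) < \<infinity>" unfolding haar by (simp add: of_nat_less_top)
        ultimately show ?thesis using contra VI[of n] unfolding VS by blast
      qed
      then have "of_nat D + ennreal \<epsilon> \<le> of_nat (haar (V (Suc n))) / of_nat (haar (V n))"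
        by (simp add: haar not_less)
      also have "\<dots> = ennreal (real (haar (V (Suc n))) / real (haar (V n)))"
        using pos by (simp add: divide_ennreal ennreal_of_nat_eq_real_of_nat)
      finally have "ennreal (real D + \<epsilon>) \<le> ennreal (real (haar (V (Suc n))) / real (haar (V n)))"
        using \<epsilon> by (simp add: ennreal_of_nat_eq_real_of_nat)
      then have "real D + \<epsilon> \<le> real (haar (V (Suc n))) / real (haar (V n))"
        by (subst (asm) ennreal_le_iff) auto
      then have "(real D + \<epsilon>) * real (haar (V n)) \<le> real (haar (V (Suc n)))"
        using pos by (simp add: pos_le_divide_eq)
      moreover have "(1 + \<epsilon>) * real (haar (V n)) \<le> (real D + \<epsilon>) * real (haar (V n))"
        using \<open>D \<ge> 1\<close> by (intro mult_right_mono) auto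
      ultimately show ?thesis by linarith
    qed
    \<comment> \<open>The induction starts with the weight of the trivial class, which is at least
      1, and itself supplies the positivity that \<open>step\<close> needs.\<close>
    have grow: "(1 + \<epsilon>) ^ n \<le> real (haar (V n))" for n
    proof (induction n)
      case 0
      have "haar (V 0) > 0" using irr_dim_pos[OF G \<pi>\<^sub>0(1)] by (simp add: haar_def V0)
      then show ?case by simp
    next
      case (Suc n)
      have "0 < (1 + \<epsilon>) ^ n" using \<epsilon> by simp
      then have "haar (V n) > 0" using Suc by simp
      have "(1 + \<epsilon>) ^ Suc n \<le> (1 + \<epsilon>) * real (haar (V n))" using Suc \<epsilon> by (simp add: mult_left_mono)
      then show ?case using step[OF \<open>haar (V n) > 0\<close>] by linarith
    qed
    have le: "(1 + \<epsilon>) ^ n \<le> real (n + 1) ^ card C" for n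
    proof -
      have "real (haar (V n)) \<le> real ((n + 1) ^ card C)" using bound[OF fin order_refl, of n] by (rule of_nat_mono)
      then show ?thesis using grow[of n] by simp
    qed
    \<comment> \<open>The exponent \<open>card C\<close> depends on K but not on n, so the
      exponential wins.\<close>
    have "(\<lambda>n. real (n + 1) ^ card C / (1 + \<epsilon>) ^ n) \<longlonglongrightarrow> 0"
      using \<epsilon> by real_asymp
    then have "eventually (\<lambda>n. real (n + 1) ^ card C / (1 + \<epsilon>) ^ n < 1) sequentially"
      by (rule order_tendstoD) simp
    then obtain n where "real (n + 1) ^ card C / (1 + \<epsilon>) ^ n < 1"
      by (auto simp: eventually_sequentially)
    then show False using le[of n] \<epsilon> by (simp add: divide_less_eq)
  qed
qed

section \<open>Application to SU(3)\<close>

lemma monoid_SU3: "Group.monoid SU3"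
proof -
  have tm: "map_matrix cnj (Finite_Cartesian_Product.transpose (A ** B))
    = map_matrix cnj (Finite_Cartesian_Product.transpose B) ** map_matrix cnj (Finite_Cartesian_Product.transpose A)"
    for A B :: "complex^3^3"
    by (simp add: Finite_Cartesian_Product.vec_eq_iff map_matrix_def Finite_Cartesian_Product.transpose_def matrix_matrix_mult_def mult.commute)
  have one: "map_matrix cnj (Finite_Cartesian_Product.mat 1 :: complex^3^3) = Finite_Cartesian_Product.mat 1"
    by (simp add: Finite_Cartesian_Product.vec_eq_iff map_matrix_def Finite_Cartesian_Product.mat_def)
  have closed: "(A ** B) ** map_matrix cnj (Finite_Cartesian_Product.transpose (A ** B)) = Finite_Cartesian_Product.mat 1"
    if A: "A ** map_matrix cnj (Finite_Cartesian_Product.transpose A) = Finite_Cartesian_Product.mat 1"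
      and B: "B ** map_matrix cnj (Finite_Cartesian_Product.transpose B) = Finite_Cartesian_Product.mat 1"
    for A B :: "complex^3^3"
  proof -
    have "(A ** B) ** map_matrix cnj (Finite_Cartesian_Product.transpose (A ** B))
      = A ** (B ** map_matrix cnj (Finite_Cartesian_Product.transpose B)) ** map_matrix cnj (Finite_Cartesian_Product.transpose A)"
      by (simp add: tm matrix_mul_assoc)
    then show ?thesis by (simp add: A B)
  qed
  show ?thesis
    by (rule monoidI)
      (auto simp: SU3_def Determinants.det_mul one matrix_mul_assoc closed)
qed

theorem proposition2p6:
  shows "irr_leptin SU3 18240"
  by (rule irr_leptin_monoid[OF monoid_SU3]) simp

end
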